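(* Given integers $w\ge 1$ and $2\le d\le 2w$, we have \[ \frac{X[n,d,w]}{V_n}\to x_{d,w}\quad\text{almost surely as } n\to\infty, \] where the limits $x_{d,w}$ are positive numbers satisfying the recurrence \[ x_{2,1}=\frac{1}{\alpha+\beta+1},\qquad x_{d,w}=\frac{1}{\alpha w+\beta+1}\bigl[\alpha_1(w-1)x_{d,w-1}+\alpha_2(w-1)x_{d-1,w-1}+\beta x_{d-2,w-1}\bigr]\quad (w\ge 2), \] with $x_{d,w}=0$ whenever $2\le d\le 2w$ does not hold.
   Context: Random graph model with parameters $0<p\le 1$, $q,r\in[0,1]$. Vertices, edges and triangles carry nonnegative integer weights. At time $0$ there is a single triangle on three vertices; the triangle has weight $1$ and each of its three edges has weight $1$ (all other pairs/triplets have weight $0$). At each step $n=1,2,\dots$ three vertices interact, chosen as follows, all the choices of rule being independent of the past. With probability $p$ a new vertex is added and it interacts with two distinct old vertices: with (conditional) probability $r$ these are the endpoints of an edge chosen with probability proportional to its weight, and with probability $1-r$ they are two distinct old vertices chosen uniformly at random. With probability $1-p$ three old vertices interact: with (conditional) probability $q$ a triangle is chosen with probability proportional to its weight, and with probability $1-q$ three distinct old vertices are chosen uniformly at random. After the three interacting vertices are selected, any missing edges among them are drawn, and the weight of the triangle they form and of each of its three edges is increased by $1$. The weight of a vertex is the sum of the weights of the triangles containing it; its degree is its number of neighbours. $V_n$ is the number of vertices after $n$ steps ($V_0=3$), and $X[n,d,w]$ is the number of vertices having degree $d$ and weight $w$ after $n$ steps. Constants: $\alpha_1=(1-p)q$,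 $\alpha_2=\frac{2pr}{3}$, $\alpha=\alpha_1+\alpha_2$, $\beta=2(1-r)+\frac{3(1-p)(1-q)}{p}$.
   Formalization: Positivity of all limits is asserted only when α₁, α₂ and β are positive (otherwise nonnegativity), because it fails at boundary parameters: e.g. for p=1 one has α₁=0 and the recurrence gives x_{2,2}=0; convergence and the recurrence are kept for all parameters. *)

theory Defs
  imports "HOL-Probability.Probability" "HOL-Library.Monad_Syntax"
begin

text \<open>
  The vertices are \<open>0, \<dots>, num_verts - 1\<close>, numbered in order of arrival. Edges are two-element and
  triangles three-element vertex sets. Both are kept in multisets whose multiplicities are the
  weights: a pair or triplet of weight 0 is one that does not occur, and the edges of the graph are
  the elements of the multiset \<open>edges\<close>.
\<close>

record graph_state =
  num_verts :: nat
  edges :: "nat set multiset"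
  triangles :: "nat set multiset"

definition verts :: "graph_state \<Rightarrow> nat set" where
  "verts G = {..<num_verts G}"

definition init_state :: graph_state where
  "init_state = \<lparr> num_verts = 3, edges = {# {0, 1}, {0, 2}, {1, 2} #}, triangles = {# {0, 1, 2} #} \<rparr>"

definition subsets_of_size :: "nat \<Rightarrow> 'a set \<Rightarrow> 'a set set" where
  "subsets_of_size k A = {B. B \<subseteq> A \<and> card B = k}"

definition interact :: "nat set \<Rightarrow> graph_state \<Rightarrow> graph_state" where
  "interact T G = G\<lparr> edges := edges G + mset_set (subsets_of_size 2 T),
                     triangles := add_mset T (triangles G) \<rparr>"

definition add_vertex :: "graph_state \<Rightarrow> graph_state" where
  "add_vertex G = G\<lparr> num_verts := Suc (num_verts G) \<rparr>"

text \<open>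
  A draw from \<^const>\<open>pmf_of_multiset\<close> is proportional to multiplicity, that is, to weight. In the
  first branch the new vertex carries the number \<open>num_verts G\<close>.
\<close>

definition step :: "real \<Rightarrow> real \<Rightarrow> real \<Rightarrow> graph_state \<Rightarrow> graph_state pmf" where
  "step p q r G = do {
     new \<leftarrow> bernoulli_pmf p;
     if new then do {
       preferential \<leftarrow> bernoulli_pmf r;
       e \<leftarrow> (if preferential then pmf_of_multiset (edges G)
            else pmf_of_set (subsets_of_size 2 (verts G)));
       return_pmf (interact (insert (num_verts G) e) (add_vertex G))
     } else do {
       preferential \<leftarrow> bernoulli_pmf q;
       T \<leftarrow> (if preferential then pmf_of_multiset (triangles G)
            else pmf_of_set (subsets_of_size 3 (verts G)));
       return_pmf (interact T G)
     }
   }"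

text \<open>
  The graph process is a Markov chain with transition kernel \<^const>\<open>step\<close>. Since the reachable states
  form a countable set, its law is determined by the probabilities of finite initial paths.
\<close>

definition graph_process ::
  "real \<Rightarrow> real \<Rightarrow> real \<Rightarrow> 'a measure \<Rightarrow> (nat \<Rightarrow> 'a \<Rightarrow> graph_state) \<Rightarrow> bool" where
  "graph_process p q r M G \<longleftrightarrow>
     prob_space M \<and>
     (\<forall>n. G n \<in> measurable M (count_space UNIV)) \<and>
     (AE \<omega> in M. G 0 \<omega> = init_state) \<and>
     (\<forall>n g. measure M {\<omega> \<in> space M. \<forall>k\<le>Suc n. G k \<omega> = g k} =
            measure M {\<omega> \<in> space M. \<forall>k\<le>n. G k \<omega> = g k} * pmf (step p q r (g n)) (g (Suc n)))"

definition vertex_weight :: "graph_state \<Rightarrow> nat \<Rightarrow> nat" where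
  "vertex_weight G v = (\<Sum>T | T \<in># triangles G \<and> v \<in> T. count (triangles G) T)"

definition degree :: "graph_state \<Rightarrow> nat \<Rightarrow> nat" where
  "degree G v = card {u. {u, v} \<in># edges G}"

definition num_verts_with :: "graph_state \<Rightarrow> nat \<Rightarrow> nat \<Rightarrow> nat" where
  "num_verts_with G d w = card {v \<in> verts G. degree G v = d \<and> vertex_weight G v = w}"

definition \<alpha>1 :: "real \<Rightarrow> real \<Rightarrow> real" where
  "\<alpha>1 p q = (1 - p) * q"

definition \<alpha>2 :: "real \<Rightarrow> real \<Rightarrow> real" where
  "\<alpha>2 p r = 2 * p * r / 3"

definition \<alpha> :: "real \<Rightarrow> real \<Rightarrow> real \<Rightarrow> real" where
  "\<alpha> p q r = \<alpha>1 p q + \<alpha>2 p r"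

definition \<beta> :: "real \<Rightarrow> real \<Rightarrow> real \<Rightarrow> real" where
  "\<beta> p q r = 2 * (1 - r) + 3 * (1 - p) * (1 - q) / p"

end

theory Submission
  imports Defs "HOL-Library.Discrete_Functions"
begin

text \<open>
  The counts are treated as a stochastic approximation. Let \<open>Y n\<close> be the number of vertices of degree \<open>d\<close> and weight
  \<open>w\<close> after \<open>n\<close> steps. After \<open>n\<close> steps the triangles have total weight \<open>n + 1\<close> and the edges total weight
  \<open>3 * (n + 1)\<close>, so a vertex of weight \<open>w\<close> takes part in the next step with probability
  \<open>\<alpha> * w / (n + 1) + p * \<beta> / V n\<close>. In such a step its weight grows by 1. Its degree grows by 0 if a triangle is
  drawn by weight, by 1 if an edge is drawn by weight, and, unless the uniformly chosen vertices contain an edge,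
  by 2 if the choice is uniform. There are at most \<open>3 * (n + 1)\<close> edges among about \<open>n^2\<close> pairs, so the exceptional
  case has probability of order \<open>1 / n\<close>. The expected change of \<open>Y n\<close> given the past is therefore
  \<open>b n - c n * Y n\<close>, where \<open>n * c n\<close> tends to \<open>\<alpha> * w + \<beta>\<close> and \<open>b n\<close> is determined, up to an error that tends to 0,
  by the counts for weight \<open>w - 1\<close> and by the arrival of new vertices of degree 2 and weight 1
  (\<open>expectation_num_verts_with\<close>).

  The difference between the actual and the expected change is a bounded martingale difference. Such differences
  are orthogonal (\<open>noise_orthogonal\<close>), and a bounded orthogonal sequence satisfies the strong law of large numbers
  (\<open>strong_law_bounded_orthogonal\<close>). Vanishing averages of the noise are all that the deterministic recursion needs in order to give
  \<open>Y n / n \<rightarrow> b / (1 + \<alpha> * w + \<beta>)\<close> with \<open>b\<close> the limit of \<open>b n\<close> (\<open>noisy_linear_recursion_limit\<close>). The number of vertices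
  is the simplest instance: its expected change is \<open>p\<close>, so \<open>V n / n \<rightarrow> p\<close>. Induction on the weight then
  identifies the limits, starting from the fact that no vertex has weight 0 and that \<open>2 \<le> d \<le> 2 * w\<close> holds for
  every vertex (\<open>well_formed\<close>).
\<close>

section \<open>Linear recursions with small average noise\<close>

text \<open>
  The averages of a null sequence are null: the finitely many large terms are divided by an
  unbounded number, and the average of the others is small.
\<close>

lemma cesaro_null:
  fixes a :: "nat \<Rightarrow> real"
  assumes "a \<longlonglongrightarrow> 0"
  shows "(\<lambda>n. (\<Sum>k<n. a k) / real n) \<longlonglongrightarrow> 0"
proof (rule LIMSEQ_I)
  fix e :: real assume "0 < e"
  then obtain N where N: "\<And>n. n \<ge> N \<Longrightarrow> \<bar>a n\<bar> < e / 2"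
    using LIMSEQ_D[OF assms, of "e / 2"] by auto
  define B where "B = (\<Sum>k<N. \<bar>a k\<bar>)"
  obtain n0 :: nat where n0: "2 * B / e < real n0" using reals_Archimedean2 by blast
  show "\<exists>no. \<forall>n\<ge>no. norm ((\<Sum>k<n. a k) / real n - 0) < e"
  proof (intro exI[of _ "max (Suc n0) N"] allI impI)
    fix n assume n: "max (Suc n0) N \<le> n"
    have "\<bar>\<Sum>k<n. a k\<bar> \<le> (\<Sum>k<n. \<bar>a k\<bar>)" by simp
    also have "\<dots> = B + (\<Sum>k\<in>{N..<n}. \<bar>a k\<bar>)"
      unfolding B_def using n sum.atLeastLessThan_concat[of 0 N n "\<lambda>k. \<bar>a k\<bar>"]
      by (simp add: atLeast0LessThan)
    also have "(\<Sum>k\<in>{N..<n}. \<bar>a k\<bar>) \<le> (\<Sum>k\<in>{N..<n}. e / 2)"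
      using N by (intro sum_mono less_imp_le) auto
    also have "\<dots> \<le> real n * (e / 2)" using \<open>0 < e\<close> by (auto simp: field_simps)
    finally have "\<bar>\<Sum>k<n. a k\<bar> \<le> B + real n * (e / 2)" by simp
    moreover have "B < real n * (e / 2)"
    proof -
      have "2 * B / e < real n" using n0 n by linarith
      thus ?thesis using \<open>0 < e\<close> by (simp add: field_simps)
    qed
    ultimately have "\<bar>\<Sum>k<n. a k\<bar> < e * real n" by (simp add: field_simps)
    thus "norm ((\<Sum>k<n. a k) / real n - 0) < e" using n by (simp add: field_simps)
  qed
qed

text \<open>
  If \<open>y n\<close> grows like \<open>l * n\<close>, the increments must be about \<open>l\<close>, so \<open>l = b0 - \<gamma> * l\<close>, which explains the
  limit. The deviation from this line, with the accumulated noise removed as well, again satisfies a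
  linear recursion: its factors \<open>1 - c n\<close> lie in \<open>[0, 1]\<close> from some point on and its perturbation tends
  to 0. Its absolute value therefore grows at most by the partial sums of a null sequence, that is,
  sublinearly.
\<close>

lemma noisy_linear_recursion_limit:
  fixes y b c \<xi> :: "nat \<Rightarrow> real"
  assumes rec: "\<And>n. y (Suc n) - y n = b n - c n * y n + \<xi> n"
    and noise: "(\<lambda>n. (\<Sum>k<n. \<xi> k) / real n) \<longlonglongrightarrow> 0"
    and c_nonneg: "\<And>n. 0 \<le> c n"
    and c_lim: "(\<lambda>n. real n * c n) \<longlonglongrightarrow> \<gamma>" and "0 \<le> \<gamma>"
    and b_lim: "b \<longlonglongrightarrow> b0"
  shows "(\<lambda>n. y n / real n) \<longlonglongrightarrow> b0 / (1 + \<gamma>)"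
proof -
  define l where "l = b0 / (1 + \<gamma>)"
  define S where "S n = (\<Sum>k<n. \<xi> k)" for n
  define E where "E n = y n - S n - real n * l" for n
  define \<delta> where "\<delta> n = b n - c n * S n - real n * c n * l - l" for n
  have E_Suc: "E (Suc n) = (1 - c n) * E n + \<delta> n" for n
    using rec[of n] by (simp add: E_def \<delta>_def S_def algebra_simps)
  have "(\<lambda>n. (real n * c n) * (S n / real n)) \<longlonglongrightarrow> \<gamma> * 0"
    unfolding S_def by (intro tendsto_mult c_lim noise)
  moreover have "(real n * c n) * (S n / real n) = c n * S n" for n
    by (cases "n = 0") (auto simp: S_def)
  ultimately have cS: "(\<lambda>n. c n * S n) \<longlonglongrightarrow> 0" by simp
  have "\<delta> \<longlonglongrightarrow> b0 - 0 - \<gamma> * l - l"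
    unfolding \<delta>_def by (intro tendsto_diff tendsto_mult b_lim cS c_lim tendsto_const)
  also have "b0 - 0 - \<gamma> * l - l = 0"
    using \<open>0 \<le> \<gamma>\<close> by (simp add: l_def field_simps)
  finally have \<delta>_lim: "\<delta> \<longlonglongrightarrow> 0" .
  have "(\<lambda>n. (real n * c n) * (1 / real n)) \<longlonglongrightarrow> \<gamma> * 0"
    by (intro tendsto_mult c_lim lim_1_over_n)
  hence "eventually (\<lambda>n. (real n * c n) * (1 / real n) < 1) sequentially"
    by (intro order_tendstoD) auto
  hence "eventually (\<lambda>n. c n < 1) sequentially"
    using eventually_gt_at_top[of 0] by eventually_elim auto
  then obtain N where N: "\<And>n. n \<ge> N \<Longrightarrow> c n < 1" by (auto simp: eventually_sequentially)
  have E_bound: "\<bar>E n\<bar> \<le> \<bar>E N\<bar> + (\<Sum>k<n. \<bar>\<delta> k\<bar>)" if "n \<ge> N" for n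
    using that
  proof (induction n rule: dec_induct)
    case base
    show ?case by (simp add: sum_nonneg)
  next
    case (step n)
    have "\<bar>(1 - c n) * E n\<bar> \<le> \<bar>E n\<bar>"
      using N[OF step.hyps(1)] c_nonneg[of n] by (simp add: abs_mult mult_left_le_one_le)
    thus ?case using step.IH by (simp add: E_Suc)
  qed
  have "(\<lambda>n. E n / real n) \<longlonglongrightarrow> 0"
  proof (rule Lim_null_comparison)
    have "(\<lambda>n. \<bar>E N\<bar> * (1 / real n) + (\<Sum>k<n. \<bar>\<delta> k\<bar>) / real n) \<longlonglongrightarrow> \<bar>E N\<bar> * 0 + 0"
      by (intro tendsto_add tendsto_mult tendsto_const lim_1_over_n cesaro_null
            tendsto_rabs_zero \<delta>_lim)
    thus "(\<lambda>n. \<bar>E N\<bar> * (1 / real n) + (\<Sum>k<n. \<bar>\<delta> k\<bar>) / real n) \<longlonglongrightarrow> 0" by simp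
    show "\<forall>\<^sub>F n in sequentially.
        norm (E n / real n) \<le> \<bar>E N\<bar> * (1 / real n) + (\<Sum>k<n. \<bar>\<delta> k\<bar>) / real n"
      using eventually_ge_at_top[of N]
      by eventually_elim (auto simp: add_divide_distrib[symmetric] intro!: divide_right_mono E_bound)
  qed
  hence "(\<lambda>n. E n / real n + S n / real n + l) \<longlonglongrightarrow> 0 + 0 + l"
    unfolding S_def by (intro tendsto_add noise tendsto_const)
  moreover have "eventually (\<lambda>n. E n / real n + S n / real n + l = y n / real n) sequentially"
    using eventually_gt_at_top[of 0] by eventually_elim (auto simp: E_def field_simps)
  ultimately show ?thesis
    unfolding l_def[symmetric] by (auto intro: Lim_transform_eventually)
qed

text \<open>
  Between two consecutive squares there are only about \<open>2 * sqrt n\<close> indices, so bounded summands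
  cannot change the average by more than a multiple of \<open>1 / sqrt n\<close> in between.
\<close>

lemma mean_null_of_square_times:
  fixes \<xi> :: "nat \<Rightarrow> real"
  assumes bdd: "\<And>k. \<bar>\<xi> k\<bar> \<le> C"
    and squares: "(\<lambda>m. (\<Sum>k<m\<^sup>2. \<xi> k) / real (m\<^sup>2)) \<longlonglongrightarrow> 0"
  shows "(\<lambda>n. (\<Sum>k<n. \<xi> k) / real n) \<longlonglongrightarrow> 0"
proof (rule Lim_null_comparison)
  have C: "0 \<le> C" using bdd[of 0] by linarith
  have sqrt_lim: "filterlim floor_sqrt at_top sequentially"
    unfolding filterlim_at_top
  proof
    fix Z
    show "\<forall>\<^sub>F n in sequentially. Z \<le> floor_sqrt n"
      using eventually_ge_at_top[of "Z\<^sup>2"] by eventually_elim (simp add: le_floor_sqrt_iff)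
  qed
  let ?u = "\<lambda>m. \<bar>(\<Sum>k<m\<^sup>2. \<xi> k) / real (m\<^sup>2)\<bar> + 2 * C * (1 / real m)"
  have "?u \<longlonglongrightarrow> \<bar>0\<bar> + 2 * C * 0"
    by (intro tendsto_add tendsto_rabs squares tendsto_mult tendsto_const lim_1_over_n)
  hence "?u \<longlonglongrightarrow> 0" by simp
  from filterlim_compose[OF this sqrt_lim]
  show "(\<lambda>n. ?u (floor_sqrt n)) \<longlonglongrightarrow> 0" .
  show "\<forall>\<^sub>F n in sequentially. norm ((\<Sum>k<n. \<xi> k) / real n) \<le> ?u (floor_sqrt n)"
    using eventually_gt_at_top[of 0]
  proof eventually_elim
    fix n :: nat assume n: "0 < n"
    define m where "m = floor_sqrt n"
    have m: "0 < m" "m\<^sup>2 \<le> n" using n by (auto simp: m_def)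
    have gap: "n - m\<^sup>2 \<le> 2 * m"
      using Suc_floor_sqrt_power2_gt[of n] by (simp add: m_def[symmetric] power2_eq_square)
    have "(\<Sum>k<n. \<xi> k) = (\<Sum>k<m\<^sup>2. \<xi> k) + (\<Sum>k\<in>{m\<^sup>2..<n}. \<xi> k)"
      using m sum.atLeastLessThan_concat[of 0 "m\<^sup>2" n \<xi>] by (simp add: atLeast0LessThan)
    hence "\<bar>\<Sum>k<n. \<xi> k\<bar> \<le> \<bar>\<Sum>k<m\<^sup>2. \<xi> k\<bar> + \<bar>\<Sum>k\<in>{m\<^sup>2..<n}. \<xi> k\<bar>" by linarith
    also have "\<bar>\<Sum>k\<in>{m\<^sup>2..<n}. \<xi> k\<bar> \<le> (\<Sum>k\<in>{m\<^sup>2..<n}. C)"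
      by (intro order.trans[OF sum_abs] sum_mono bdd)
    also have "\<dots> = C * real (n - m\<^sup>2)" by simp
    also have "\<dots> \<le> C * real (2 * m)"
      using C gap by (intro mult_left_mono) linarith+
    finally have "\<bar>\<Sum>k<n. \<xi> k\<bar> \<le> \<bar>\<Sum>k<m\<^sup>2. \<xi> k\<bar> + 2 * C * real m" by simp
    hence "\<bar>\<Sum>k<n. \<xi> k\<bar> / real n \<le> (\<bar>\<Sum>k<m\<^sup>2. \<xi> k\<bar> + 2 * C * real m) / real (m\<^sup>2)"
      using m n C by (intro frac_le) (auto intro!: add_nonneg_nonneg)
    also have "\<dots> = ?u m" using m by (simp add: add_divide_distrib power2_eq_square)
    finally show "norm ((\<Sum>k<n. \<xi> k) / real n) \<le> ?u (floor_sqrt n)"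
      using n by (simp add: m_def)
  qed
qed

section \<open>A strong law for bounded orthogonal random variables\<close>

context prob_space
begin

text \<open>
  By monotone convergence the sum of the squares has finite expectation. It is then almost surely
  finite, which forces the terms to 0.
\<close>

lemma AE_tendsto_zero_of_summable_second_moments:
  fixes Y :: "nat \<Rightarrow> 'a \<Rightarrow> real"
  assumes [measurable]: "\<And>n. Y n \<in> borel_measurable M"
    and "\<And>n. integrable M (\<lambda>\<omega>. (Y n \<omega>)\<^sup>2)"
    and bnd: "\<And>n. expectation (\<lambda>\<omega>. (Y n \<omega>)\<^sup>2) \<le> a n" and "summable a"
  shows "AE \<omega> in M. (\<lambda>n. Y n \<omega>) \<longlonglongrightarrow> 0"
proof -
  have a: "0 \<le> a n" for n
    using bnd[of n] by (rule order.trans[rotated]) (simp add: integral_nonneg_AE)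
  have "(\<integral>\<^sup>+\<omega>. (\<Sum>n. ennreal ((Y n \<omega>)\<^sup>2)) \<partial>M) = (\<Sum>n. \<integral>\<^sup>+\<omega>. ennreal ((Y n \<omega>)\<^sup>2) \<partial>M)"
    by (intro nn_integral_suminf) measurable
  also have "\<dots> = (\<Sum>n. ennreal (expectation (\<lambda>\<omega>. (Y n \<omega>)\<^sup>2)))"
    using assms(2) by (intro arg_cong[where f = suminf] ext nn_integral_eq_integral) auto
  also have "\<dots> \<le> (\<Sum>n. ennreal (a n))"
    by (intro suminf_le ennreal_leI bnd) auto
  also have "\<dots> = ennreal (\<Sum>n. a n)"
    using a \<open>summable a\<close> by (intro suminf_ennreal2) auto
  also have "\<dots> < \<infinity>" by simp
  finally have "AE \<omega> in M. (\<Sum>n. ennreal ((Y n \<omega>)\<^sup>2)) \<noteq> \<infinity>"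
    by (intro nn_integral_noteq_infinite) auto
  thus ?thesis
  proof eventually_elim
    case (elim \<omega>)
    hence "summable (\<lambda>n. (Y n \<omega>)\<^sup>2)" by (intro summable_suminf_not_top) auto
    hence "(\<lambda>n. (Y n \<omega>)\<^sup>2) \<longlonglongrightarrow> 0" by (rule summable_LIMSEQ_zero)
    thus ?case by simp
  qed
qed

text \<open>
  By orthogonality the second moment of the \<open>n\<close>-th partial sum is at most \<open>n * C^2\<close>, so that of the
  \<open>n\<close>-th average is at most \<open>C^2 / n\<close>. This is summable along the squares, and boundedness covers the
  indices between them.
\<close>

lemma strong_law_bounded_orthogonal:
  fixes \<xi> :: "nat \<Rightarrow> 'a \<Rightarrow> real"
  assumes [measurable]: "\<And>n. \<xi> n \<in> borel_measurable M"
    and bdd: "\<And>n. AE \<omega> in M. \<bar>\<xi> n \<omega>\<bar> \<le> C"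
    and orth: "\<And>m n. m < n \<Longrightarrow> expectation (\<lambda>\<omega>. \<xi> m \<omega> * \<xi> n \<omega>) = 0"
  shows "AE \<omega> in M. (\<lambda>n. (\<Sum>k<n. \<xi> k \<omega>) / real n) \<longlonglongrightarrow> 0"
proof -
  have prod_bdd: "AE \<omega> in M. \<bar>\<xi> m \<omega> * \<xi> n \<omega>\<bar> \<le> C\<^sup>2" for m n
    using bdd[of m] bdd[of n]
  proof eventually_elim
    case (elim \<omega>)
    hence "\<bar>\<xi> m \<omega>\<bar> * \<bar>\<xi> n \<omega>\<bar> \<le> C * C" by (intro mult_mono) auto
    thus ?case by (simp add: abs_mult power2_eq_square)
  qed
  have prod_int: "integrable M (\<lambda>\<omega>. \<xi> m \<omega> * \<xi> n \<omega>)" for m n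
    using prod_bdd[of m n] by (intro integrable_const_bound[where B = "C\<^sup>2"]) auto
  have square_eq: "(\<Sum>k<n. \<xi> k \<omega>)\<^sup>2 = (\<Sum>i<n. \<Sum>j<n. \<xi> i \<omega> * \<xi> j \<omega>)" for n \<omega>
    by (simp add: power2_eq_square sum_product)
  have S_int: "integrable M (\<lambda>\<omega>. (\<Sum>k<n. \<xi> k \<omega>)\<^sup>2)" for n
    unfolding square_eq by (intro Bochner_Integration.integrable_sum prod_int)
  have S_var: "expectation (\<lambda>\<omega>. (\<Sum>k<n. \<xi> k \<omega>)\<^sup>2) \<le> real n * C\<^sup>2" for n
  proof -
    have off: "expectation (\<lambda>\<omega>. \<xi> i \<omega> * \<xi> j \<omega>) = 0" if "i \<noteq> j" for i j
      using that orth[of i j] orth[of j i] by (cases "i < j") (auto simp: mult.commute)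
    have "expectation (\<lambda>\<omega>. (\<Sum>k<n. \<xi> k \<omega>)\<^sup>2) = (\<Sum>i<n. \<Sum>j<n. expectation (\<lambda>\<omega>. \<xi> i \<omega> * \<xi> j \<omega>))"
      unfolding square_eq by (simp add: Bochner_Integration.integral_sum prod_int Bochner_Integration.integrable_sum)
    also have "\<dots> = (\<Sum>i<n. \<Sum>j<n. if i = j then expectation (\<lambda>\<omega>. \<xi> i \<omega> * \<xi> i \<omega>) else 0)"
      by (intro sum.cong refl) (auto simp: off)
    also have "\<dots> = (\<Sum>i<n. expectation (\<lambda>\<omega>. \<xi> i \<omega> * \<xi> i \<omega>))" by simp
    also have "\<dots> \<le> (\<Sum>i<n. C\<^sup>2)"
    proof (intro sum_mono)
      fix i
      have "AE \<omega> in M. \<xi> i \<omega> * \<xi> i \<omega> \<le> C\<^sup>2" using prod_bdd[of i i] by eventually_elim auto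
      hence "expectation (\<lambda>\<omega>. \<xi> i \<omega> * \<xi> i \<omega>) \<le> expectation (\<lambda>_. C\<^sup>2)"
        by (intro integral_mono_AE prod_int) auto
      thus "expectation (\<lambda>\<omega>. \<xi> i \<omega> * \<xi> i \<omega>) \<le> C\<^sup>2" by (simp add: prob_space)
    qed
    finally show ?thesis by simp
  qed
  have "AE \<omega> in M. (\<lambda>m. (\<Sum>k<m\<^sup>2. \<xi> k \<omega>) / real (m\<^sup>2)) \<longlonglongrightarrow> 0"
  proof (rule AE_tendsto_zero_of_summable_second_moments)
    show "summable (\<lambda>m. C\<^sup>2 * (1 / real m ^ 2))"
      using inverse_power_summable[of 2, where 'a = real]
      by (intro summable_mult) (simp add: inverse_eq_divide)
    fix m
    have *: "((\<Sum>k<m\<^sup>2. \<xi> k \<omega>) / real (m\<^sup>2))\<^sup>2 = (\<Sum>k<m\<^sup>2. \<xi> k \<omega>)\<^sup>2 / real m ^ 4" for \<omega>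
      by (simp add: power_divide power_mult[symmetric])
    show "integrable M (\<lambda>\<omega>. ((\<Sum>k<m\<^sup>2. \<xi> k \<omega>) / real (m\<^sup>2))\<^sup>2)"
      unfolding * by (intro integrable_divide_zero S_int)
    have "expectation (\<lambda>\<omega>. ((\<Sum>k<m\<^sup>2. \<xi> k \<omega>) / real (m\<^sup>2))\<^sup>2)
        \<le> real (m\<^sup>2) * C\<^sup>2 / real m ^ 4"
      unfolding * using S_var[of "m\<^sup>2"] by (simp add: divide_right_mono)
    also have "\<dots> = C\<^sup>2 * (1 / real m ^ 2)"
      by (cases "m = 0") (auto simp: field_simps power2_eq_square power4_eq_xxxx)
    finally show "expectation (\<lambda>\<omega>. ((\<Sum>k<m\<^sup>2. \<xi> k \<omega>) / real (m\<^sup>2))\<^sup>2) \<le> C\<^sup>2 * (1 / real m ^ 2)" .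
  qed auto
  moreover have "AE \<omega> in M. \<forall>n. \<bar>\<xi> n \<omega>\<bar> \<le> C" using bdd by (simp add: AE_all_countable)
  ultimately show ?thesis
    by eventually_elim (rule mean_null_of_square_times, auto)
qed

end

section \<open>Markov chains with finitely many transitions from each state\<close>

text \<open>
  The law of the process is given only through the probabilities of finite paths. Finite branching on a
  set \<open>R\<close> of states that is closed under transitions makes the set of paths of each length finite up to
  a null set, so expectations of functions of the path are finite sums; this matters because the state
  space may be uncountable, and then the path up to time \<open>n\<close> need not be a measurable map into
  the discrete space of lists.
\<close>

locale finitely_branching_chain = prob_space M for M :: "'a measure" +
  fixes K :: "'s \<Rightarrow> 's pmf" and s0 :: 's and R :: "'s set" and X :: "nat \<Rightarrow> 'a \<Rightarrow> 's"
  assumes measurable_X [measurable]: "\<And>n. X n \<in> measurable M (count_space UNIV)"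
    and start: "AE \<omega> in M. X 0 \<omega> = s0"
    and path_prob: "\<And>n g. prob {\<omega> \<in> space M. \<forall>k\<le>Suc n. X k \<omega> = g k} =
        prob {\<omega> \<in> space M. \<forall>k\<le>n. X k \<omega> = g k} * pmf (K (g n)) (g (Suc n))"
    and s0_R: "s0 \<in> R"
    and K_closed: "\<And>s. s \<in> R \<Longrightarrow> set_pmf (K s) \<subseteq> R"
    and K_finite: "\<And>s. s \<in> R \<Longrightarrow> finite (set_pmf (K s))"
begin

text \<open>
  The most recent state comes first, so that a transition is a \<open>Cons\<close> and the current state is the head.
\<close>

primrec history :: "nat \<Rightarrow> 'a \<Rightarrow> 's list" where
  "history 0 \<omega> = [X 0 \<omega>]"
| "history (Suc n) \<omega> = X (Suc n) \<omega> # history n \<omega>"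

primrec histories :: "nat \<Rightarrow> 's list set" where
  "histories 0 = {[s0]}"
| "histories (Suc n) = (\<Union>h\<in>histories n. (\<lambda>s. s # h) ` set_pmf (K (hd h)))"

text \<open>
  The increments of the martingale part of \<open>f (X n)\<close>.
\<close>

definition noise :: "('s \<Rightarrow> real) \<Rightarrow> nat \<Rightarrow> 'a \<Rightarrow> real" where
  "noise f n \<omega> = f (X (Suc n) \<omega>) - measure_pmf.expectation (K (X n \<omega>)) f"

lemma length_history: "length (history n \<omega>) = Suc n"
  by (induction n) auto

lemma hd_history [simp]: "hd (history n \<omega>) = X n \<omega>"
  by (cases n) auto

lemma nth_history: "k \<le> n \<Longrightarrow> history n \<omega> ! (n - k) = X k \<omega>"
  by (induction n) (auto simp: le_Suc_eq Suc_diff_le)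

lemma history_eq_iff:
  assumes "length h = Suc n"
  shows "history n \<omega> = h \<longleftrightarrow> (\<forall>k\<le>n. X k \<omega> = h ! (n - k))"
proof
  assume "\<forall>k\<le>n. X k \<omega> = h ! (n - k)"
  hence "history n \<omega> ! i = h ! i" if "i \<le> n" for i
    using that nth_history[of "n - i" n \<omega>] by simp
  thus "history n \<omega> = h" using assms by (intro nth_equalityI) (auto simp: length_history)
qed (auto simp: nth_history)

lemma measurable_history_eq [measurable]: "{\<omega> \<in> space M. history n \<omega> = h} \<in> sets M"
proof (cases "length h = Suc n")
  case True
  have "{\<omega> \<in> space M. \<forall>k\<le>n. X k \<omega> = h ! (n - k)} \<in> sets M" by measurable
  thus ?thesis by (simp add: history_eq_iff[OF True])
next
  case False
  hence "{\<omega> \<in> space M. history n \<omega> = h} = {}" using length_history by auto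
  thus ?thesis by (simp only: sets.empty_sets)
qed

lemma prob_history_Suc:
  assumes "length h = Suc n"
  shows "prob {\<omega> \<in> space M. history (Suc n) \<omega> = s # h} =
    prob {\<omega> \<in> space M. history n \<omega> = h} * pmf (K (hd h)) s"
proof -
  let ?g = "\<lambda>k. (s # h) ! (Suc n - k)"
  have "history (Suc n) \<omega> = s # h \<longleftrightarrow> (\<forall>k\<le>Suc n. X k \<omega> = ?g k)" for \<omega>
    by (rule history_eq_iff) (simp add: assms)
  moreover have "history n \<omega> = h \<longleftrightarrow> (\<forall>k\<le>n. X k \<omega> = ?g k)" for \<omega>
    by (subst history_eq_iff[OF assms]) (auto simp: Suc_diff_le)
  moreover have "h ! 0 = hd h" using assms by (cases h) auto
  ultimately show ?thesis using path_prob[of n ?g] by simp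
qed

lemma histories_D:
  assumes "h \<in> histories n"
  shows "length h = Suc n" "hd h \<in> R"
  using assms by (induction n arbitrary: h) (use s0_R K_closed in fastforce)+

lemma finite_histories: "finite (histories n)"
  by (induction n) (auto simp: histories_D K_finite)

lemma sum_histories_Suc:
  "(\<Sum>h\<in>histories (Suc n). F h) = (\<Sum>h\<in>histories n. \<Sum>s\<in>set_pmf (K (hd h)). F (s # h))"
proof -
  have "(\<Sum>h\<in>histories (Suc n). F h)
      = (\<Sum>h\<in>histories n. \<Sum>h'\<in>(\<lambda>s. s # h) ` set_pmf (K (hd h)). F h')"
    unfolding histories.simps
    by (rule sum.UNION_disjoint) (auto simp: finite_histories histories_D K_finite)
  also have "\<dots> = (\<Sum>h\<in>histories n. \<Sum>s\<in>set_pmf (K (hd h)). F (s # h))"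
    by (intro sum.cong refl, subst sum.reindex) (auto simp: inj_on_def)
  finally show ?thesis .
qed

text \<open>
  The probabilities of the paths in \<open>histories n\<close> add up to 1, because each factor
  \<open>pmf (K s)\<close> adds up to 1 over its support.
\<close>

lemma AE_history_in_histories: "AE \<omega> in M. history n \<omega> \<in> histories n"
proof -
  have total: "(\<Sum>h\<in>histories n. prob {\<omega> \<in> space M. history n \<omega> = h}) = 1"
  proof (induction n)
    case 0
    have "{\<omega> \<in> space M. X 0 \<omega> = s0} \<in> events" by measurable
    thus ?case using start by (simp add: prob_Collect_eq_1)
  next
    case (Suc n)
    have "(\<Sum>h\<in>histories (Suc n). prob {\<omega> \<in> space M. history (Suc n) \<omega> = h})
      = (\<Sum>h\<in>histories n. \<Sum>s\<in>set_pmf (K (hd h)).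
            prob {\<omega> \<in> space M. history n \<omega> = h} * pmf (K (hd h)) s)"
      unfolding sum_histories_Suc
      by (intro sum.cong refl prob_history_Suc) (auto dest: histories_D)
    also have "\<dots> = (\<Sum>h\<in>histories n. prob {\<omega> \<in> space M. history n \<omega> = h})"
      by (intro sum.cong refl)
         (simp add: sum_distrib_left[symmetric] sum_pmf_eq_1 K_finite histories_D)
    finally show ?case using Suc.IH by simp
  qed
  have eq: "{\<omega> \<in> space M. history n \<omega> \<in> histories n}
      = (\<Union>h\<in>histories n. {\<omega> \<in> space M. history n \<omega> = h})" by auto
  have "prob {\<omega> \<in> space M. history n \<omega> \<in> histories n} = 1"
    unfolding eq
    by (subst finite_measure_finite_Union) (auto simp: finite_histories disjoint_family_on_def total)
  moreover have "{\<omega> \<in> space M. history n \<omega> \<in> histories n} \<in> events"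
    unfolding eq by (intro sets.finite_UN finite_histories) measurable
  ultimately show ?thesis by (simp add: prob_Collect_eq_1)
qed

lemma AE_path:
  "AE \<omega> in M. X 0 \<omega> = s0 \<and> (\<forall>n. X n \<omega> \<in> R \<and> X (Suc n) \<omega> \<in> set_pmf (K (X n \<omega>)))"
proof -
  have "AE \<omega> in M. \<forall>n. history n \<omega> \<in> histories n"
    by (simp add: AE_all_countable AE_history_in_histories)
  thus ?thesis using start
  proof eventually_elim
    case (elim \<omega>)
    show ?case
    proof (intro conjI allI)
      fix n
      show "X n \<omega> \<in> R" using elim histories_D(2)[of "history n \<omega>" n] by simp
      have "history (Suc n) \<omega> \<in> histories (Suc n)" using elim by blast
      thus "X (Suc n) \<omega> \<in> set_pmf (K (X n \<omega>))" by auto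
    qed (use elim in auto)
  qed
qed

lemma expectation_history:
  fixes F :: "'s list \<Rightarrow> real"
  assumes [measurable]: "(\<lambda>\<omega>. F (history n \<omega>)) \<in> borel_measurable M"
  shows "expectation (\<lambda>\<omega>. F (history n \<omega>))
    = (\<Sum>h\<in>histories n. F h * prob {\<omega> \<in> space M. history n \<omega> = h})"
proof -
  have "expectation (\<lambda>\<omega>. F (history n \<omega>))
      = expectation (\<lambda>\<omega>. \<Sum>h\<in>histories n. F h * indicator {\<omega> \<in> space M. history n \<omega> = h} \<omega>)"
  proof (rule integral_cong_AE)
    show "AE \<omega> in M. F (history n \<omega>)
        = (\<Sum>h\<in>histories n. F h * indicator {\<omega> \<in> space M. history n \<omega> = h} \<omega>)"
      using AE_history_in_histories[of n] AE_space
    proof eventually_elim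
      case (elim \<omega>)
      hence "(\<Sum>h\<in>histories n. F h * indicator {\<omega> \<in> space M. history n \<omega> = h} \<omega>)
          = (\<Sum>h\<in>histories n. if h = history n \<omega> then F h else 0)"
        by (intro sum.cong refl) (auto simp: indicator_def)
      thus ?case using elim by (simp add: finite_histories)
    qed
  qed measurable
  also have "\<dots> = (\<Sum>h\<in>histories n. F h * prob {\<omega> \<in> space M. history n \<omega> = h})"
  proof (subst Bochner_Integration.integral_sum)
    show "integrable M (\<lambda>\<omega>. F h * indicator {\<omega> \<in> space M. history n \<omega> = h} \<omega>)" for h
      by (intro integrable_mult_right integrable_real_indicator) (auto simp: emeasure_eq_measure)
  qed simp
  finally show ?thesis .
qed

lemma measurable_noise [measurable]: "noise f n \<in> borel_measurable M"
proof -
  have "(\<lambda>\<omega>. g (X n \<omega>)) \<in> borel_measurable M" for g :: "'s \<Rightarrow> real" and n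
    by (rule measurable_compose[OF measurable_X]) simp
  thus ?thesis unfolding noise_def by (intro borel_measurable_diff)
qed

text \<open>
  The earlier factor is a function of the path up to time \<open>n\<close>. Given that path, the later factor
  averages to 0 by the choice of its centring. Both statements are identities between finite sums over
  paths.
\<close>

lemma noise_orthogonal:
  assumes "m < n"
  shows "expectation (\<lambda>\<omega>. noise f m \<omega> * noise f n \<omega>) = 0"
proof -
  let ?E = "\<lambda>s. measure_pmf.expectation (K s) f"
  \<comment> \<open>The earlier noise as a function of the path up to time n, and the product as a function
    of the path up to time n + 1; in a list with the latest state first, the state at time k
    up to n has index n - k.\<close>
  define A where "A h = f (h ! (n - Suc m)) - ?E (h ! (n - m))" for h
  define F where "F h = A (tl h) * (f (hd h) - ?E (hd (tl h)))" for h
  have noise_F: "noise f m \<omega> * noise f n \<omega> = F (history (Suc n) \<omega>)" for \<omega>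
    using assms nth_history[of m n \<omega>] nth_history[of "Suc m" n \<omega>]
    by (simp add: noise_def F_def A_def)
  have "(\<lambda>\<omega>. F (history (Suc n) \<omega>)) \<in> borel_measurable M"
    unfolding noise_F[symmetric] by measurable
  hence "expectation (\<lambda>\<omega>. noise f m \<omega> * noise f n \<omega>)
      = (\<Sum>h\<in>histories (Suc n). F h * prob {\<omega> \<in> space M. history (Suc n) \<omega> = h})"
    unfolding noise_F by (rule expectation_history)
  also have "\<dots> = (\<Sum>h\<in>histories n. A h * prob {\<omega> \<in> space M. history n \<omega> = h} *
      (\<Sum>s\<in>set_pmf (K (hd h)). (f s - ?E (hd h)) * pmf (K (hd h)) s))"
    unfolding sum_histories_Suc sum_distrib_left
  proof (intro sum.cong refl)
    fix h s assume "h \<in> histories n"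
    from prob_history_Suc[OF histories_D(1)[OF this], of s]
    show "F (s # h) * prob {\<omega> \<in> space M. history (Suc n) \<omega> = s # h}
        = A h * prob {\<omega> \<in> space M. history n \<omega> = h} * ((f s - ?E (hd h)) * pmf (K (hd h)) s)"
      by (simp add: F_def)
  qed
  also have "\<dots> = 0"
  proof (intro sum.neutral ballI)
    fix h assume h: "h \<in> histories n"
    let ?S = "set_pmf (K (hd h))"
    have fin: "finite ?S" using h by (simp add: K_finite histories_D)
    have "(\<Sum>s\<in>?S. (f s - ?E (hd h)) * pmf (K (hd h)) s)
        = (\<Sum>s\<in>?S. f s * pmf (K (hd h)) s) - ?E (hd h) * (\<Sum>s\<in>?S. pmf (K (hd h)) s)"
      by (simp add: algebra_simps sum_subtractf sum_distrib_left)
    also have "\<dots> = 0"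
      using fin by (simp add: sum_pmf_eq_1 integral_measure_pmf_real[of ?S])
    finally show "A h * prob {\<omega> \<in> space M. history n \<omega> = h} *
        (\<Sum>s\<in>?S. (f s - ?E (hd h)) * pmf (K (hd h)) s) = 0" by simp
  qed
  finally show ?thesis .
qed

lemma noise_mean_null:
  assumes incr: "\<And>s s'. s \<in> R \<Longrightarrow> s' \<in> set_pmf (K s) \<Longrightarrow> \<bar>f s' - f s\<bar> \<le> C"
  shows "AE \<omega> in M. (\<lambda>n. (\<Sum>k<n. noise f k \<omega>) / real n) \<longlonglongrightarrow> 0"
proof (rule strong_law_bounded_orthogonal)
  fix n
  show "AE \<omega> in M. \<bar>noise f n \<omega>\<bar> \<le> 2 * C"
    using AE_path
  proof eventually_elim
    case (elim \<omega>)
    define s where "s = X n \<omega>"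
    have s: "s \<in> R" "X (Suc n) \<omega> \<in> set_pmf (K s)" using elim by (auto simp: s_def)
    let ?S = "set_pmf (K s)"
    have fin: "finite ?S" by (simp add: K_finite s)
    have "measure_pmf.expectation (K s) f - f s
        = (\<Sum>s'\<in>?S. f s' * pmf (K s) s') - f s * (\<Sum>s'\<in>?S. pmf (K s) s')"
      using fin by (simp add: sum_pmf_eq_1 integral_measure_pmf_real[of ?S])
    also have "\<dots> = (\<Sum>s'\<in>?S. (f s' - f s) * pmf (K s) s')"
      by (simp add: algebra_simps sum_subtractf sum_distrib_left)
    also have "\<bar>\<dots>\<bar> \<le> (\<Sum>s'\<in>?S. C * pmf (K s) s')"
      by (intro order.trans[OF sum_abs] sum_mono)
         (auto simp: abs_mult intro!: mult_right_mono incr s(1))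
    also have "\<dots> = C" using fin by (simp add: sum_distrib_left[symmetric] sum_pmf_eq_1)
    finally have "\<bar>measure_pmf.expectation (K s) f - f s\<bar> \<le> C" .
    with incr[OF s] show ?case by (auto simp: noise_def s_def[symmetric])
  qed
qed (auto simp: noise_orthogonal)

end

section \<open>Averages over the subsets of a given size\<close>

lemma finite_subsets_of_size: "finite A \<Longrightarrow> finite (subsets_of_size k A)"
  by (simp add: subsets_of_size_def)

lemma card_subsets_of_size: "finite A \<Longrightarrow> card (subsets_of_size k A) = card A choose k"
  by (simp add: subsets_of_size_def n_subsets)

text \<open>
  Removing \<open>E\<close> leaves an arbitrary \<open>(k - card E)\<close>-subset of \<open>A - E\<close>. The case \<open>card E = 1\<close> says how often a
  point is covered by the \<open>k\<close>-subsets, the case \<open>card E = 2\<close> how often a pair is.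
\<close>

lemma card_subsets_of_size_containing:
  assumes "finite A" "E \<subseteq> A" "card E \<le> k"
  shows "card {B \<in> subsets_of_size k A. E \<subseteq> B} = (card A - card E) choose (k - card E)"
proof -
  have finE: "finite E" using assms finite_subset by blast
  have "bij_betw (\<lambda>B. B - E) {B \<in> subsets_of_size k A. E \<subseteq> B} (subsets_of_size (k - card E) (A - E))"
  proof (rule bij_betw_byWitness[where f' = "\<lambda>C. C \<union> E"])
    show "(\<lambda>C. C \<union> E) ` subsets_of_size (k - card E) (A - E) \<subseteq> {B \<in> subsets_of_size k A. E \<subseteq> B}"
    proof safe
      fix C assume C: "C \<in> subsets_of_size (k - card E) (A - E)"
      hence "finite C" using assms(1) by (auto simp: subsets_of_size_def intro: finite_subset)
      hence "card (C \<union> E) = card C + card E"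
        using C finE by (intro card_Un_disjoint) (auto simp: subsets_of_size_def)
      thus "C \<union> E \<in> subsets_of_size k A" using C assms by (auto simp: subsets_of_size_def)
    qed
  qed (use finE in \<open>auto simp: subsets_of_size_def card_Diff_subset\<close>)
  hence "card {B \<in> subsets_of_size k A. E \<subseteq> B} = card (subsets_of_size (k - card E) (A - E))"
    by (rule bij_betw_same_card)
  also have "\<dots> = (card A - card E) choose (k - card E)"
    using assms finE by (simp add: card_subsets_of_size card_Diff_subset)
  finally show ?thesis .
qed

lemma sum_subsets_of_size:
  fixes f :: "'a \<Rightarrow> real"
  assumes "finite A" "1 \<le> k"
  shows "(\<Sum>B\<in>subsets_of_size k A. \<Sum>v\<in>B. f v) = real ((card A - 1) choose (k - 1)) * (\<Sum>v\<in>A. f v)"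
proof -
  let ?S = "subsets_of_size k A"
  have "(\<Sum>B\<in>?S. \<Sum>v\<in>B. f v) = (\<Sum>B\<in>?S. \<Sum>v | v \<in> A \<and> v \<in> B. f v)"
    by (intro sum.cong refl) (auto simp: subsets_of_size_def)
  also have "\<dots> = (\<Sum>v\<in>A. \<Sum>B | B \<in> ?S \<and> v \<in> B. f v)"
    using assms(1) by (intro sum.swap_restrict finite_subsets_of_size)
  also have "\<dots> = (\<Sum>v\<in>A. real ((card A - 1) choose (k - 1)) * f v)"
    using assms card_subsets_of_size_containing[of A "{v}" k for v]
    by (intro sum.cong refl) simp
  finally show ?thesis by (simp add: sum_distrib_left)
qed

text \<open>
  A uniformly chosen \<open>k\<close>-subset contains each given point with probability \<open>k / card A\<close>.
\<close>

lemma average_subsets_of_size: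
  fixes f :: "'a \<Rightarrow> real"
  assumes "finite A" "1 \<le> k" "k \<le> card A"
  shows "(\<Sum>B\<in>subsets_of_size k A. \<Sum>v\<in>B. f v) / real (card (subsets_of_size k A))
    = real k / real (card A) * (\<Sum>v\<in>A. f v)"
proof -
  have "real k * real (card A choose k) = real (card A) * real ((card A - 1) choose (k - 1))"
    using times_binomial_minus1_eq[of k "card A"] assms(2) by (simp flip: of_nat_mult)
  moreover have "A \<noteq> {}" using assms(2,3) by auto
  ultimately have "real ((card A - 1) choose (k - 1)) = real k / real (card A) * real (card A choose k)"
    using assms by (simp add: field_simps)
  moreover have "real (card A choose k) > 0" using assms(3) by (simp add: zero_less_binomial)
  ultimately show ?thesis
    using assms by (simp add: sum_subsets_of_size card_subsets_of_size)
qed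

text \<open>
  Union bound: a uniformly chosen \<open>k\<close>-subset contains a given pair with probability
  \<open>k (k - 1) / (n (n - 1))\<close>, where \<open>n = card A\<close>.
\<close>

lemma proportion_containing_pair_le:
  assumes A: "finite A" and k: "2 \<le> k" "k \<le> card A"
    and E: "finite E" "\<And>e. e \<in> E \<Longrightarrow> e \<subseteq> A \<and> card e = 2"
  shows "real (card {B \<in> subsets_of_size k A. \<exists>e\<in>E. e \<subseteq> B}) / real (card (subsets_of_size k A))
    \<le> real k * (real k - 1) * real (card E) / (real (card A) * (real (card A) - 1))"
proof -
  let ?S = "subsets_of_size k A" and ?n = "card A"
  have "card {B \<in> ?S. \<exists>e\<in>E. e \<subseteq> B} = card (\<Union>e\<in>E. {B \<in> ?S. e \<subseteq> B})"
    by (intro arg_cong[where f = card]) auto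
  also have "\<dots> \<le> (\<Sum>e\<in>E. card {B \<in> ?S. e \<subseteq> B})" by (intro card_UN_le E)
  also have "\<dots> = (\<Sum>e\<in>E. (?n - 2) choose (k - 2))"
    using A E k card_subsets_of_size_containing[of A _ k] by (intro sum.cong refl) auto
  finally have "real (card {B \<in> ?S. \<exists>e\<in>E. e \<subseteq> B}) \<le> real (card E * ((?n - 2) choose (k - 2)))"
    by (simp only: sum_constant of_nat_le_iff) simp
  hence le: "real (card {B \<in> ?S. \<exists>e\<in>E. e \<subseteq> B}) \<le> real (card E) * real ((?n - 2) choose (k - 2))"
    by simp
  have "k * (?n choose k) = ?n * ((?n - 1) choose (k - 1))"
    using k by (intro times_binomial_minus1_eq) auto
  hence 1: "real k * real (?n choose k) = real ?n * real ((?n - 1) choose (k - 1))"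
    by (metis of_nat_mult)
  have "(k - 1) * ((?n - 1) choose (k - 1)) = (?n - 1) * ((?n - 1 - 1) choose (k - 1 - 1))"
    using k by (intro times_binomial_minus1_eq) auto
  hence "real (k - 1) * real ((?n - 1) choose (k - 1)) = real (?n - 1) * real ((?n - 2) choose (k - 2))"
    by (metis of_nat_mult diff_diff_left one_add_one)
  hence 2: "(real k - 1) * real ((?n - 1) choose (k - 1))
      = (real ?n - 1) * real ((?n - 2) choose (k - 2))"
    using k by (simp add: of_nat_diff)
  \<comment> \<open>Two applications of the absorption identity relate the binomial coefficients for n and n - 2.\<close>
  have "real k * (real k - 1) * real (?n choose k) = (real k - 1) * (real k * real (?n choose k))"
    by simp
  also have "\<dots> = real ?n * ((real k - 1) * real ((?n - 1) choose (k - 1)))"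
    unfolding 1 by simp
  also have "\<dots> = real ?n * (real ?n - 1) * real ((?n - 2) choose (k - 2))"
    unfolding 2 by simp
  finally have "real k * (real k - 1) * real (?n choose k)
      = real ?n * (real ?n - 1) * real ((?n - 2) choose (k - 2))" .
  hence ratio: "real ((?n - 2) choose (k - 2))
      = real k * (real k - 1) * real (?n choose k) / (real ?n * (real ?n - 1))"
    using k by (simp add: field_simps)
  have pos: "real (?n choose k) > 0" using k by (simp add: zero_less_binomial)
  show ?thesis
    using le pos by (simp add: card_subsets_of_size A ratio field_simps)
qed

text \<open>
  The form in which uniform choices of interacting vertices enter the proof. The set \<open>E\<close> will be the set of
  edges: the effect of an interaction is additive over its vertices when none of the old vertices
  involved are adjacent, and the other choices are rare.
\<close>

lemma average_subsets_of_size_approx: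
  fixes f :: "'a \<Rightarrow> real" and \<Delta> :: "'a set \<Rightarrow> real"
  assumes A: "finite A" and k: "2 \<le> k" "k \<le> card A"
    and E: "finite E" "\<And>e. e \<in> E \<Longrightarrow> e \<subseteq> A \<and> card e = 2"
    and exact: "\<And>B. B \<in> subsets_of_size k A \<Longrightarrow> (\<And>e. e \<in> E \<Longrightarrow> \<not> e \<subseteq> B) \<Longrightarrow> \<Delta> B = (\<Sum>v\<in>B. f v)"
    and approx: "\<And>B. B \<in> subsets_of_size k A \<Longrightarrow> \<bar>\<Delta> B - (\<Sum>v\<in>B. f v)\<bar> \<le> c"
    and "0 \<le> c"
  shows "\<bar>(\<Sum>B\<in>subsets_of_size k A. \<Delta> B) / real (card (subsets_of_size k A))
      - real k / real (card A) * (\<Sum>v\<in>A. f v)\<bar>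
    \<le> c * (real k * (real k - 1) * real (card E) / (real (card A) * (real (card A) - 1)))"
proof -
  let ?S = "subsets_of_size k A" and ?bad = "{B \<in> subsets_of_size k A. \<exists>e\<in>E. e \<subseteq> B}"
  have fin: "finite ?S" using A by (rule finite_subsets_of_size)
  have "(\<Sum>B\<in>?S. \<Delta> B) / real (card ?S) - real k / real (card A) * (\<Sum>v\<in>A. f v)
      = (\<Sum>B\<in>?S. \<Delta> B - (\<Sum>v\<in>B. f v)) / real (card ?S)"
    using average_subsets_of_size[of A k f] A k by (simp add: sum_subtractf diff_divide_distrib)
  also have "(\<Sum>B\<in>?S. \<Delta> B - (\<Sum>v\<in>B. f v)) = (\<Sum>B\<in>?bad. \<Delta> B - (\<Sum>v\<in>B. f v))"
    using fin exact by (intro sum.mono_neutral_right) auto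
  also have "\<bar>(\<Sum>B\<in>?bad. \<Delta> B - (\<Sum>v\<in>B. f v)) / real (card ?S)\<bar> \<le> c * (real (card ?bad) / real (card ?S))"
  proof -
    have "\<bar>\<Sum>B\<in>?bad. \<Delta> B - (\<Sum>v\<in>B. f v)\<bar> \<le> (\<Sum>B\<in>?bad. c)"
      by (intro order.trans[OF sum_abs] sum_mono approx) auto
    thus ?thesis by (simp add: abs_divide divide_right_mono mult.commute)
  qed
  also have "\<dots> \<le> c * (real k * (real k - 1) * real (card E) / (real (card A) * (real (card A) - 1)))"
    using \<open>0 \<le> c\<close> by (intro mult_left_mono proportion_containing_pair_le A k E)
  finally show ?thesis .
qed

section \<open>Weights and degrees under an interaction\<close>

text \<open>
  Every interaction adds a triangle together with its three edges, so the edge weights are determined by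
  the triangle weights. This one identity yields that the total edge weight is three times the total
  triangle weight and that the edges at a vertex have twice the weight of the vertex.
\<close>

definition coherent :: "graph_state \<Rightarrow> bool" where
  "coherent G \<longleftrightarrow> edges G = (\<Sum>T\<in>#triangles G. mset_set (subsets_of_size 2 T)) \<and>
     (\<forall>T\<in>#triangles G. T \<subseteq> verts G \<and> card T = 3)"

lemma finite_verts [simp]: "finite (verts G)"
  by (simp add: verts_def)

lemma card_verts [simp]: "card (verts G) = num_verts G"
  by (simp add: verts_def)

lemma card_3_finite: "card T = 3 \<Longrightarrow> finite T"
  by (rule card_ge_0_finite) simp

lemma card_2_finite: "card T = 2 \<Longrightarrow> finite T"
  by (rule card_ge_0_finite) simp

lemma coherent_triangleD:
  assumes "coherent G" "T \<in># triangles G"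
  shows "T \<subseteq> verts G" "card T = 3"
  using assms by (auto simp: coherent_def)

lemma coherent_edge_iff:
  assumes "coherent G"
  shows "e \<in># edges G \<longleftrightarrow> card e = 2 \<and> (\<exists>T\<in>#triangles G. e \<subseteq> T)"
proof -
  have "finite (subsets_of_size 2 T)" if "T \<in># triangles G" for T
    using that assms card_3_finite by (intro finite_subsets_of_size) (auto simp: coherent_def)
  thus ?thesis using assms by (auto simp: coherent_def subsets_of_size_def)
qed

lemma coherent_edgeD:
  assumes "coherent G" "e \<in># edges G"
  shows "e \<subseteq> verts G" "card e = 2"
  using assms coherent_triangleD by (fastforce simp: coherent_edge_iff)+

lemma vertex_weight_eq_size: "vertex_weight G v = size {#T \<in># triangles G. v \<in> T#}"
  unfolding vertex_weight_def size_multiset_overloaded_eq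
  by (intro sum.cong) auto

text \<open>
  Double counting: a triangle drawn with probability proportional to its weight contains a vertex with
  probability proportional to the weight of the vertex. This is the source of preferential attachment.
\<close>

lemma sum_triangles:
  fixes f :: "nat \<Rightarrow> real"
  assumes "coherent G"
  shows "(\<Sum>T\<in>#triangles G. \<Sum>v\<in>T. f v) = (\<Sum>v\<in>verts G. real (vertex_weight G v) * f v)"
proof -
  have "(\<Sum>T\<in>#N. \<Sum>v\<in>T. f v) = (\<Sum>v\<in>verts G. real (size {#T \<in># N. v \<in> T#}) * f v)"
    if "\<forall>T\<in>#N. T \<subseteq> verts G" for N
    using that
  proof (induction N)
    case (add T N)
    have "(\<Sum>v\<in>T. f v) = (\<Sum>v\<in>verts G. if v \<in> T then f v else 0)"
      using add.prems by (simp add: sum.inter_restrict[symmetric] Int_absorb1)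
    with add show ?case
      by (simp add: sum.distrib[symmetric]) (intro sum.cong refl, simp add: algebra_simps)
  qed auto
  thus ?thesis using assms by (simp add: coherent_def vertex_weight_eq_size)
qed

lemma sum_edges_triangles:
  assumes "coherent G"
  shows "(\<Sum>e\<in>#edges G. g e) = (\<Sum>T\<in>#triangles G. \<Sum>e\<in>subsets_of_size 2 T. g e :: 'a :: comm_monoid_add)"
proof -
  have "(\<Sum>e\<in>#(\<Sum>T\<in>#N. mset_set (subsets_of_size 2 T)). g e) = (\<Sum>T\<in>#N. \<Sum>e\<in>subsets_of_size 2 T. g e)"
    for N :: "nat set multiset"
    by (induction N) (auto simp: sum_unfold_sum_mset)
  thus ?thesis using assms by (simp add: coherent_def)
qed

text \<open>
  Each vertex of a triangle lies on two of its three edges; hence the factor 2 in comparison with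
  triangles.
\<close>

lemma sum_edges:
  fixes f :: "nat \<Rightarrow> real"
  assumes "coherent G"
  shows "(\<Sum>e\<in>#edges G. \<Sum>v\<in>e. f v) = 2 * (\<Sum>v\<in>verts G. real (vertex_weight G v) * f v)"
proof -
  have "(\<Sum>e\<in>subsets_of_size 2 T. \<Sum>v\<in>e. f v) = 2 * (\<Sum>v\<in>T. f v)" if "T \<in># triangles G" for T
    using coherent_triangleD[OF assms that] by (subst sum_subsets_of_size) (auto simp: card_3_finite)
  hence "(\<Sum>e\<in>#edges G. \<Sum>v\<in>e. f v) = (\<Sum>T\<in>#triangles G. 2 * (\<Sum>v\<in>T. f v))"
    unfolding sum_edges_triangles[OF assms] by (intro arg_cong[where f = sum_mset] image_mset_cong)
  thus ?thesis by (simp add: sum_triangles[OF assms] flip: sum_mset_distrib_left)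
qed

lemma size_edges:
  assumes "coherent G"
  shows "size (edges G) = 3 * size (triangles G)"
proof -
  have "size (edges G) = (\<Sum>T\<in>#triangles G. card (subsets_of_size 2 T))"
    using sum_edges_triangles[OF assms, of "\<lambda>_. 1::nat"] by simp
  also have "\<dots> = (\<Sum>T\<in>#triangles G. 3)"
    using coherent_triangleD[OF assms]
    by (intro arg_cong[where f = sum_mset] image_mset_cong)
       (auto simp: card_subsets_of_size card_3_finite choose_two)
  finally show ?thesis by simp
qed


lemma finite_neighbours:
  assumes "coherent G"
  shows "finite {u. {u, v} \<in># edges G}"
  by (rule finite_subset[OF _ finite_verts[of G]]) (use coherent_edgeD(1)[OF assms] in blast)

lemma verts_interact [simp]: "verts (interact T G) = verts G"
  and num_verts_interact [simp]: "num_verts (interact T G) = num_verts G"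
  and triangles_interact [simp]: "triangles (interact T G) = add_mset T (triangles G)"
  by (auto simp: interact_def verts_def)

lemma verts_add_vertex [simp]: "verts (add_vertex G) = insert (num_verts G) (verts G)"
  and num_verts_add_vertex [simp]: "num_verts (add_vertex G) = Suc (num_verts G)"
  and edges_add_vertex [simp]: "edges (add_vertex G) = edges G"
  and triangles_add_vertex [simp]: "triangles (add_vertex G) = triangles G"
  by (auto simp: add_vertex_def verts_def)

lemma num_verts_notin_verts [simp]: "num_verts G \<notin> verts G"
  by (simp add: verts_def)

lemma coherent_interact:
  assumes "coherent G" "T \<subseteq> verts G" "card T = 3"
  shows "coherent (interact T G)"
  using assms by (auto simp: coherent_def) (simp add: interact_def)

lemma coherent_add_vertex: "coherent G \<Longrightarrow> coherent (add_vertex G)"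
  by (auto simp: coherent_def)

lemma edge_interact_iff:
  assumes "card T = 3"
  shows "{u, v} \<in># edges (interact T G) \<longleftrightarrow> {u, v} \<in># edges G \<or> (u \<in> T \<and> v \<in> T \<and> u \<noteq> v)"
  using card_3_finite[OF assms]
  by (auto simp: interact_def finite_subsets_of_size) (auto simp: subsets_of_size_def card_insert_if)

lemma degree_interact:
  assumes "coherent G" "card T = 3"
  shows "degree (interact T G) v =
    degree G v + (if v \<in> T then card {u \<in> T - {v}. {u, v} \<notin># edges G} else 0)"
proof (cases "v \<in> T")
  case True
  have "{u. {u, v} \<in># edges (interact T G)}
      = {u. {u, v} \<in># edges G} \<union> {u \<in> T - {v}. {u, v} \<notin># edges G}"
    using True by (auto simp: edge_interact_iff[OF assms(2)])
  moreover have "card \<dots> = degree G v + card {u \<in> T - {v}. {u, v} \<notin># edges G}"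
    unfolding degree_def using card_3_finite[OF assms(2)]
    by (intro card_Un_disjoint finite_neighbours[OF assms(1)]) auto
  ultimately show ?thesis using True by (simp add: degree_def)
qed (simp add: degree_def edge_interact_iff[OF assms(2)])

lemma vertex_weight_interact:
  "vertex_weight (interact T G) v = vertex_weight G v + of_bool (v \<in> T)"
  by (simp add: vertex_weight_eq_size)

lemma degree_add_vertex [simp]: "degree (add_vertex G) v = degree G v"
  by (simp add: degree_def)

lemma vertex_weight_add_vertex [simp]: "vertex_weight (add_vertex G) v = vertex_weight G v"
  by (simp add: vertex_weight_def)

text \<open>
  A vertex that is about to be added is isolated and has weight 0.
\<close>

lemma outside_vertex:
  assumes "coherent G" "v \<notin> verts G"
  shows "degree G v = 0" "vertex_weight G v = 0" "{u, v} \<notin># edges G"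
proof -
  show edge: "{u, v} \<notin># edges G" for u using coherent_edgeD(1)[OF assms(1)] assms(2) by blast
  show "degree G v = 0" by (simp add: degree_def edge)
  have "{#T \<in># triangles G. v \<in> T#} = {#}"
    using coherent_triangleD(1)[OF assms(1)] assms(2) by (auto simp: filter_mset_eq_conv)
  thus "vertex_weight G v = 0" by (simp add: vertex_weight_eq_size)
qed

text \<open>
  The indicator is real-valued so that the counts become sums to which averaging applies directly.
\<close>

definition has_status :: "graph_state \<Rightarrow> nat \<Rightarrow> nat \<Rightarrow> nat \<Rightarrow> real" where
  "has_status G d w v = of_bool (degree G v = d \<and> vertex_weight G v = w)"

lemma num_verts_with_eq_sum: "real (num_verts_with G d w) = (\<Sum>v\<in>verts G. has_status G d w v)"
  by (simp add: num_verts_with_def has_status_def sum_of_bool_eq Int_def)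

text \<open>
  Only the three interacting vertices can change degree or weight.
\<close>

lemma num_verts_with_interact:
  assumes "coherent G" "T \<subseteq> verts G" "card T = 3"
  shows "real (num_verts_with (interact T G) d w) - real (num_verts_with G d w)
    = (\<Sum>v\<in>T. has_status (interact T G) d w v - has_status G d w v)"
proof -
  have "real (num_verts_with (interact T G) d w) - real (num_verts_with G d w)
    = (\<Sum>v\<in>verts G. has_status (interact T G) d w v - has_status G d w v)"
    by (simp add: num_verts_with_eq_sum sum_subtractf)
  also have "\<dots> = (\<Sum>v\<in>T. has_status (interact T G) d w v - has_status G d w v)"
    using assms by (intro sum.mono_neutral_right)
      (auto simp: has_status_def degree_interact vertex_weight_interact)
  finally show ?thesis .
qed

text \<open>
  The new vertex interacting with the pair \<open>e\<close> of old vertices.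
\<close>

definition attach :: "nat set \<Rightarrow> graph_state \<Rightarrow> graph_state" where
  "attach e G = interact (insert (num_verts G) e) (add_vertex G)"

context
  fixes G e
  assumes G: "coherent G" and e: "e \<subseteq> verts G" "card e = 2"
begin

lemma card_attached: "card (insert (num_verts G) e) = 3"
  using e num_verts_notin_verts[of G] card_2_finite[OF e(2)] by (subst card_insert_disjoint) auto

lemma coherent_attach: "coherent (attach e G)"
  unfolding attach_def using e G card_attached
  by (intro coherent_interact coherent_add_vertex) auto

lemma verts_attach: "verts (attach e G) = insert (num_verts G) (verts G)"
  by (simp add: attach_def)

lemma vertex_weight_attach:
  "vertex_weight (attach e G) v = vertex_weight G v + of_bool (v = num_verts G \<or> v \<in> e)"
  by (simp add: attach_def vertex_weight_interact)

lemma degree_attach: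
  "degree (attach e G) v = degree G v +
     (if v \<in> insert (num_verts G) e
      then card {u \<in> insert (num_verts G) e - {v}. {u, v} \<notin># edges G} else 0)"
  unfolding attach_def using degree_interact[OF coherent_add_vertex[OF G] card_attached, of v] by simp

lemma attach_new_vertex:
  "degree (attach e G) (num_verts G) = 2" "vertex_weight (attach e G) (num_verts G) = 1"
proof -
  note new = outside_vertex[OF G num_verts_notin_verts]
  have "{u \<in> insert (num_verts G) e - {num_verts G}. {u, num_verts G} \<notin># edges G} = e"
    using e num_verts_notin_verts[of G] new(3) by auto
  thus "degree (attach e G) (num_verts G) = 2" using e by (simp add: degree_attach new)
  show "vertex_weight (attach e G) (num_verts G) = 1" by (simp add: vertex_weight_attach new)
qed

text \<open>
  An old vertex gains the new vertex as a neighbour, and also the other vertex of the pair unless it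
  already was one.
\<close>

lemma degree_attach_old:
  assumes "v \<in> e"
  shows "degree (attach e G) v = degree G v + (if e \<in># edges G then 1 else 2)"
proof -
  have nv: "num_verts G \<noteq> v" using assms e num_verts_notin_verts[of G] by auto
  have new: "{num_verts G, v} \<notin># edges G"
    using outside_vertex(3)[OF G num_verts_notin_verts[of G], of v] by (simp add: insert_commute)
  obtain u where u: "e = {u, v}" "u \<noteq> v"
    using e(2) assms by (auto simp: card_2_iff)
  have nu: "num_verts G \<noteq> u" using u e num_verts_notin_verts[of G] by auto
  have "{x \<in> insert (num_verts G) e - {v}. {x, v} \<notin># edges G}
      = (if e \<in># edges G then {num_verts G} else {num_verts G, u})"
    using u nv new by auto
  thus ?thesis using assms nu by (simp add: degree_attach)
qed

text \<open>
  The new vertex starts with degree 2 and weight 1, which accounts for the indicator. Before the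
  interaction it is isolated, so it has not been counted, as \<open>d\<close> is positive.
\<close>

lemma num_verts_with_attach:
  assumes "1 \<le> d"
  shows "real (num_verts_with (attach e G) d w) - real (num_verts_with G d w)
    = of_bool (d = 2 \<and> w = 1) + (\<Sum>v\<in>e. has_status (attach e G) d w v - has_status G d w v)"
proof -
  let ?s = "\<lambda>v. has_status (attach e G) d w v - has_status (add_vertex G) d w v"
  have new: "num_verts G \<notin> e" "finite e" using e num_verts_notin_verts[of G] card_2_finite by auto
  have zero: "has_status G d w (num_verts G) = 0"
    using assms outside_vertex(1)[OF G num_verts_notin_verts] by (simp add: has_status_def)
  have same: "has_status (add_vertex G) d w v = has_status G d w v" for v
    by (simp add: has_status_def)
  have "real (num_verts_with (attach e G) d w) - real (num_verts_with (add_vertex G) d w)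
    = (\<Sum>v\<in>insert (num_verts G) e. ?s v)"
    unfolding attach_def using e G card_attached
    by (intro num_verts_with_interact coherent_add_vertex) auto
  moreover have "real (num_verts_with (add_vertex G) d w) = real (num_verts_with G d w)"
    by (simp add: num_verts_with_eq_sum same zero)
  moreover have "has_status (attach e G) d w (num_verts G) = of_bool (d = 2 \<and> w = 1)"
    using attach_new_vertex by (auto simp: has_status_def)
  ultimately show ?thesis using new by (simp add: same zero)
qed

end

text \<open>
  In an existing triangle no edge is new, so weights grow and degrees do not.
\<close>

lemma num_verts_with_interact_triangle:
  assumes G: "coherent G" and T: "T \<in># triangles G" and "1 \<le> w"
  shows "real (num_verts_with (interact T G) d w) - real (num_verts_with G d w)
    = (\<Sum>v\<in>T. has_status G d (w - 1) v - has_status G d w v)"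
proof -
  note T' = coherent_triangleD[OF G T]
  have "{u, v} \<in># edges G" if "u \<in> T" "v \<in> T" "u \<noteq> v" for u v
    using that T coherent_edge_iff[OF G, of "{u, v}"] by auto
  hence no_new: "{u \<in> T - {v}. {u, v} \<notin># edges G} = {}" if "v \<in> T" for v using that by auto
  have deg: "degree (interact T G) v = degree G v" if "v \<in> T" for v
    by (simp only: degree_interact[OF G T'(2)] that if_True no_new[OF that] card.empty add_0_right)
  have "has_status (interact T G) d w v = has_status G d (w - 1) v" if "v \<in> T" for v
    using that \<open>1 \<le> w\<close> by (auto simp: has_status_def deg vertex_weight_interact)
  thus ?thesis using num_verts_with_interact[OF G T'] by simp
qed

text \<open>
  Three pairwise non-adjacent vertices gain two neighbours each.
\<close>

lemma num_verts_with_interact_edgeless: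
  assumes G: "coherent G" and T: "T \<subseteq> verts G" "card T = 3" and "1 \<le> w" "2 \<le> d"
    and edgeless: "\<And>e. e \<in># edges G \<Longrightarrow> \<not> e \<subseteq> T"
  shows "real (num_verts_with (interact T G) d w) - real (num_verts_with G d w)
    = (\<Sum>v\<in>T. has_status G (d - 2) (w - 1) v - has_status G d w v)"
proof -
  have "card {u \<in> T - {v}. {u, v} \<notin># edges G} = 2" if "v \<in> T" for v
  proof -
    have "{u \<in> T - {v}. {u, v} \<notin># edges G} = T - {v}" using that edgeless by auto
    thus ?thesis using that T card_3_finite[OF T(2)] by simp
  qed
  hence "has_status (interact T G) d w v = has_status G (d - 2) (w - 1) v" if "v \<in> T" for v
    using that assms
    by (auto simp: has_status_def degree_interact[OF G T(2)] vertex_weight_interact)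
  thus ?thesis using num_verts_with_interact[OF G T] by simp
qed

lemma num_verts_with_attach_edge:
  assumes G: "coherent G" and e: "e \<in># edges G" and "1 \<le> w" "1 \<le> d"
  shows "real (num_verts_with (attach e G) d w) - real (num_verts_with G d w)
    = of_bool (d = 2 \<and> w = 1) + (\<Sum>v\<in>e. has_status G (d - 1) (w - 1) v - has_status G d w v)"
proof -
  note e' = coherent_edgeD[OF G e]
  have "has_status (attach e G) d w v = has_status G (d - 1) (w - 1) v" if "v \<in> e" for v
    using that assms
    by (auto simp: has_status_def degree_attach_old[OF G e'] vertex_weight_attach[OF G e'])
  thus ?thesis using num_verts_with_attach[OF G e' \<open>1 \<le> d\<close>] by simp
qed

lemma num_verts_with_attach_non_edge:
  assumes G: "coherent G" and e: "e \<subseteq> verts G" "card e = 2" "e \<notin># edges G" and "1 \<le> w" "2 \<le> d"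
  shows "real (num_verts_with (attach e G) d w) - real (num_verts_with G d w)
    = of_bool (d = 2 \<and> w = 1) + (\<Sum>v\<in>e. has_status G (d - 2) (w - 1) v - has_status G d w v)"
proof -
  have "has_status (attach e G) d w v = has_status G (d - 2) (w - 1) v" if "v \<in> e" for v
    using that assms
    by (auto simp: has_status_def degree_attach_old[OF G e(1,2)] vertex_weight_attach[OF G e(1,2)])
  thus ?thesis using num_verts_with_attach[OF G e(1,2), of d w] \<open>2 \<le> d\<close> by simp
qed

lemma abs_sum_status_diff_le:
  "\<bar>\<Sum>v\<in>B. has_status G d w v - has_status H d' w' v\<bar> \<le> real (card B)"
proof -
  have "\<bar>\<Sum>v\<in>B. has_status G d w v - has_status H d' w' v\<bar> \<le> (\<Sum>v\<in>B. 1)"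
    by (intro order.trans[OF sum_abs] sum_mono) (auto simp: has_status_def)
  thus ?thesis by simp
qed

section \<open>The transition kernel on reachable graphs\<close>

lemma sum_mset_eq_sum_count:
  fixes f :: "'a \<Rightarrow> real"
  assumes "finite A" "set_mset N \<subseteq> A"
  shows "(\<Sum>x\<in>#N. f x) = (\<Sum>x\<in>A. real (count N x) * f x)"
  using assms(2)
proof (induction N)
  case (add x N)
  have "(\<Sum>y\<in>A. real (count (add_mset x N) y) * f y)
      = (\<Sum>y\<in>A. real (count N y) * f y + (if y = x then f y else 0))"
    by (intro sum.cong) (auto simp: algebra_simps)
  also have "\<dots> = (\<Sum>y\<in>A. real (count N y) * f y) + f x"
    using add.prems assms(1) by (simp add: sum.distrib)
  finally show ?case using add by simp
qed simp

lemma expectation_pmf_of_multiset: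
  fixes f :: "'a \<Rightarrow> real"
  assumes "N \<noteq> {#}"
  shows "measure_pmf.expectation (pmf_of_multiset N) f = (\<Sum>x\<in>#N. f x) / real (size N)"
proof -
  have "measure_pmf.expectation (pmf_of_multiset N) f
      = (\<Sum>x\<in>set_mset N. f x * (real (count N x) / real (size N)))"
    using assms by (subst integral_measure_pmf_real[of "set_mset N"]) auto
  also have "\<dots> = (\<Sum>x\<in>set_mset N. real (count N x) * f x) / real (size N)"
    by (simp add: sum_divide_distrib mult.commute)
  finally show ?thesis by (simp add: sum_mset_eq_sum_count[of "set_mset N"])
qed

text \<open>
  The invariant of all reachable graphs. The bounds on the degree hold because a vertex enters with degree 2
  and weight 1, and every interaction raises its weight by 1 and its degree by at most 2. They confine the
  pairs of degree and weight to the range in which the limits are nonzero, which is what makes the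
  induction on the weight start and covers the shifted degrees \<open>d - 1\<close> and \<open>d - 2\<close>.
\<close>

definition well_formed :: "graph_state \<Rightarrow> bool" where
  "well_formed G \<longleftrightarrow> coherent G \<and> 3 \<le> num_verts G \<and> triangles G \<noteq> {#} \<and>
     (\<forall>v\<in>verts G. 2 \<le> degree G v \<and> degree G v \<le> 2 * vertex_weight G v)"

lemma well_formed_interact:
  assumes G: "well_formed G" and T: "T \<subseteq> verts G" "card T = 3"
  shows "well_formed (interact T G)"
proof -
  have coh: "coherent G" using G by (simp add: well_formed_def)
  have "degree (interact T G) v \<le> 2 * vertex_weight (interact T G) v" if v: "v \<in> verts G" for v
  proof (cases "v \<in> T")
    case True
    have "card {u \<in> T - {v}. {u, v} \<notin># edges G} \<le> card (T - {v})"
      using card_3_finite[OF T(2)] by (intro card_mono) auto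
    also have "\<dots> = 2" using True T by simp
    finally show ?thesis
      using True G v degree_interact[OF coh T(2), of v] vertex_weight_interact[of T G v]
      by (auto simp: well_formed_def)
  next
    case False
    thus ?thesis using G v by (simp add: well_formed_def degree_interact[OF coh T(2)] vertex_weight_interact)
  qed
  moreover have "2 \<le> degree (interact T G) v" if "v \<in> verts G" for v
    using that G degree_interact[OF coh T(2), of v] by (auto simp: well_formed_def intro: le_trans)
  ultimately show ?thesis
    using G coherent_interact[OF coh T] by (simp add: well_formed_def)
qed

lemma well_formed_attach:
  assumes G: "well_formed G" and e: "e \<subseteq> verts G" "card e = 2"
  shows "well_formed (attach e G)"
proof -
  have coh: "coherent G" using G by (simp add: well_formed_def)
  have "2 \<le> degree (attach e G) v \<and> degree (attach e G) v \<le> 2 * vertex_weight (attach e G) v"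
    if v: "v \<in> verts (attach e G)" for v
  proof -
    consider "v = num_verts G" | "v \<in> verts G" "v \<in> e" | "v \<in> verts G" "v \<notin> e" "v \<noteq> num_verts G"
      using v by (auto simp: verts_attach[OF coh e])
    thus ?thesis
    proof cases
      case 1
      thus ?thesis using attach_new_vertex[OF coh e] by simp
    next
      case 2
      thus ?thesis using G degree_attach_old[OF coh e 2(2)] vertex_weight_attach[OF coh e, of v]
        by (auto simp: well_formed_def intro: le_trans)
    next
      case 3
      thus ?thesis using G by (auto simp: well_formed_def degree_attach[OF coh e] vertex_weight_attach[OF coh e])
    qed
  qed
  thus ?thesis using G coherent_attach[OF coh e] by (simp add: well_formed_def) (simp add: attach_def)
qed

lemma doubleton_in_init: "{u, v} \<in># edges init_state \<longleftrightarrow> u \<noteq> v \<and> u < 3 \<and> v < 3"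
  by (auto simp: init_state_def doubleton_eq_iff)

lemma well_formed_init: "well_formed init_state"
proof -
  have sub: "subsets_of_size 2 {0, 1, 2 :: nat} = {{0, 1}, {0, 2}, {1, 2}}"
  proof (intro equalityI subsetI)
    fix e assume "e \<in> subsets_of_size 2 {0, 1, 2 :: nat}"
    thus "e \<in> {{0, 1}, {0, 2}, {1, 2}}"
      by (auto simp: subsets_of_size_def card_2_iff doubleton_eq_iff)
  qed (auto simp: subsets_of_size_def)
  have coh: "coherent init_state"
    by (simp add: coherent_def init_state_def verts_def sub[simplified] doubleton_eq_iff)
  have "{u. {u, v} \<in># edges init_state} = {..<3} - {v}" if "v < 3" for v
    using that by (auto simp: doubleton_in_init)
  hence "degree init_state v = 2" if "v < 3" for v using that by (simp add: degree_def)
  moreover have "vertex_weight init_state v = 1" if "v < 3" for v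
    using that by (auto simp: vertex_weight_eq_size init_state_def)
  ultimately show ?thesis using coh by (simp add: well_formed_def verts_def) (simp add: init_state_def)
qed

definition draw :: "bool \<Rightarrow> nat set multiset \<Rightarrow> nat set set \<Rightarrow> nat set pmf" where
  "draw preferential N S = (if preferential then pmf_of_multiset N else pmf_of_set S)"

text \<open>
  The kernel in a form in which the drawn set is separated from its effect.
\<close>

lemma step_eq:
  "step p q r G = bernoulli_pmf p \<bind> (\<lambda>new.
     if new then bernoulli_pmf r \<bind> (\<lambda>b.
       map_pmf (\<lambda>e. attach e G) (draw b (edges G) (subsets_of_size 2 (verts G))))
     else bernoulli_pmf q \<bind> (\<lambda>b.
       map_pmf (\<lambda>T. interact T G) (draw b (triangles G) (subsets_of_size 3 (verts G)))))"
  by (auto simp: step_def draw_def map_pmf_def attach_def intro!: bind_pmf_cong)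

context
  fixes G
  assumes G: "well_formed G"
begin

lemma well_formed_coherent: "coherent G"
  using G by (simp add: well_formed_def)

lemma subsets_of_verts_nonempty:
  assumes "k \<le> 3"
  shows "subsets_of_size k (verts G) \<noteq> {}"
proof -
  have "0 < num_verts G choose k" using G assms by (simp add: well_formed_def zero_less_binomial)
  thus ?thesis using card_subsets_of_size[OF finite_verts, of k G] by auto
qed

lemma triangles_nonempty: "triangles G \<noteq> {#}"
  using G by (simp add: well_formed_def)

lemma edges_nonempty: "edges G \<noteq> {#}"
  using size_edges[OF well_formed_coherent] triangles_nonempty by auto

lemma set_pmf_draw_pair:
  "set_pmf (draw b (edges G) (subsets_of_size 2 (verts G))) \<subseteq> subsets_of_size 2 (verts G)"
proof (cases b)
  case True
  hence "set_pmf (draw b (edges G) (subsets_of_size 2 (verts G))) = set_mset (edges G)"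
    using edges_nonempty by (simp add: draw_def)
  thus ?thesis using coherent_edgeD[OF well_formed_coherent] by (auto simp: subsets_of_size_def)
qed (simp add: draw_def finite_subsets_of_size subsets_of_verts_nonempty)

lemma set_pmf_draw_triple:
  "set_pmf (draw b (triangles G) (subsets_of_size 3 (verts G))) \<subseteq> subsets_of_size 3 (verts G)"
proof (cases b)
  case True
  hence "set_pmf (draw b (triangles G) (subsets_of_size 3 (verts G))) = set_mset (triangles G)"
    using triangles_nonempty by (simp add: draw_def)
  thus ?thesis using coherent_triangleD[OF well_formed_coherent] by (auto simp: subsets_of_size_def)
qed (simp add: draw_def finite_subsets_of_size subsets_of_verts_nonempty)

lemma set_pmf_step:
  "set_pmf (step p q r G) \<subseteq> (\<lambda>e. attach e G) ` subsets_of_size 2 (verts G) \<union>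
     (\<lambda>T. interact T G) ` subsets_of_size 3 (verts G)"
proof -
  have "set_pmf (bernoulli_pmf p \<bind> (\<lambda>new. if new then bernoulli_pmf r \<bind> A else bernoulli_pmf q \<bind> B))
      \<subseteq> (\<Union>b. set_pmf (A b)) \<union> (\<Union>b. set_pmf (B b))" for A B :: "bool \<Rightarrow> graph_state pmf"
    by (auto split: if_splits)
  hence "set_pmf (step p q r G)
      \<subseteq> (\<Union>b. (\<lambda>e. attach e G) ` set_pmf (draw b (edges G) (subsets_of_size 2 (verts G)))) \<union>
        (\<Union>b. (\<lambda>T. interact T G) ` set_pmf (draw b (triangles G) (subsets_of_size 3 (verts G))))"
    unfolding step_eq set_map_pmf[symmetric] .
  also have "\<dots> \<subseteq> (\<Union>b::bool. (\<lambda>e. attach e G) ` subsets_of_size 2 (verts G)) \<union>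
        (\<Union>b::bool. (\<lambda>T. interact T G) ` subsets_of_size 3 (verts G))"
    by (intro Un_mono UN_mono image_mono set_pmf_draw_pair set_pmf_draw_triple order_refl)
  finally show ?thesis by simp
qed

lemma finite_set_pmf_step: "finite (set_pmf (step p q r G))"
  by (rule finite_subset[OF set_pmf_step]) (simp add: finite_subsets_of_size)

lemma step_cases:
  assumes "H \<in> set_pmf (step p q r G)"
  obtains e where "e \<subseteq> verts G" "card e = 2" "H = attach e G"
  | T where "T \<subseteq> verts G" "card T = 3" "H = interact T G"
proof -
  have "H \<in> (\<lambda>e. attach e G) ` subsets_of_size 2 (verts G) \<union>
     (\<lambda>T. interact T G) ` subsets_of_size 3 (verts G)"
    using set_pmf_step assms by blast
  thus thesis using that by (auto simp: subsets_of_size_def)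
qed

lemma well_formed_step: "H \<in> set_pmf (step p q r G) \<Longrightarrow> well_formed H"
  by (erule step_cases) (simp_all add: G well_formed_attach well_formed_interact)

lemma size_triangles_step: "H \<in> set_pmf (step p q r G) \<Longrightarrow> size (triangles H) = Suc (size (triangles G))"
  by (erule step_cases) (simp_all add: attach_def)

lemma num_verts_step: "H \<in> set_pmf (step p q r G) \<Longrightarrow> \<bar>real (num_verts H) - real (num_verts G)\<bar> \<le> 1"
  by (erule step_cases) (simp_all add: attach_def)

lemma num_verts_with_step:
  assumes "H \<in> set_pmf (step p q r G)" "1 \<le> d"
  shows "\<bar>real (num_verts_with H d w) - real (num_verts_with G d w)\<bar> \<le> 3"
  using assms(1)
proof (cases rule: step_cases)
  case (1 e)
  have "\<bar>of_bool P + x\<bar> \<le> 3" if "\<bar>x\<bar> \<le> 2" for P and x :: real using that by (cases P) auto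
  thus ?thesis
    using abs_sum_status_diff_le[of H d w G d w e] 1 \<open>1 \<le> d\<close>
    by (simp add: num_verts_with_attach[OF well_formed_coherent])
next
  case (2 T)
  thus ?thesis using abs_sum_status_diff_le[of H d w G d w T]
    by (simp add: num_verts_with_interact[OF well_formed_coherent])
qed

lemma expectation_step:
  fixes f :: "graph_state \<Rightarrow> real"
  assumes "0 \<le> p" "p \<le> 1" "0 \<le> q" "q \<le> 1" "0 \<le> r" "r \<le> 1"
  shows "measure_pmf.expectation (step p q r G) f =
    p * (r * ((\<Sum>e\<in>#edges G. f (attach e G)) / real (size (edges G)))
       + (1 - r) * ((\<Sum>e\<in>subsets_of_size 2 (verts G). f (attach e G))
            / real (card (subsets_of_size 2 (verts G)))))
    + (1 - p) * (q * ((\<Sum>T\<in>#triangles G. f (interact T G)) / real (size (triangles G)))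
       + (1 - q) * ((\<Sum>T\<in>subsets_of_size 3 (verts G). f (interact T G))
            / real (card (subsets_of_size 3 (verts G)))))"
proof -
  let ?S = "\<lambda>k. subsets_of_size k (verts G)"
  have fin: "finite (set_pmf (draw b (edges G) (?S 2)))" "finite (set_pmf (draw b (triangles G) (?S 3)))" for b
    by (rule finite_subset[OF set_pmf_draw_pair] finite_subset[OF set_pmf_draw_triple],
        simp add: finite_subsets_of_size)+
  have bernoulli: "measure_pmf.expectation (bernoulli_pmf x \<bind> g) f
      = x * measure_pmf.expectation (g True) f + (1 - x) * measure_pmf.expectation (g False) f"
    if "0 \<le> x" "x \<le> 1" "\<And>b. finite (set_pmf (g b))" for x g
    using that by (subst pmf_expectation_bind[of UNIV]) (auto simp: UNIV_bool)
  show ?thesis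
    unfolding step_eq
    using assms fin edges_nonempty triangles_nonempty subsets_of_verts_nonempty
    by (simp add: bernoulli draw_def expectation_pmf_of_multiset integral_pmf_of_set
          finite_subsets_of_size)
qed

lemma expectation_num_verts:
  assumes "0 \<le> p" "p \<le> 1" "0 \<le> q" "q \<le> 1" "0 \<le> r" "r \<le> 1"
  shows "measure_pmf.expectation (step p q r G) (\<lambda>H. real (num_verts H)) = real (num_verts G) + p"
proof -
  have "card (subsets_of_size k (verts G)) \<noteq> 0" if "k \<le> 3" for k
    using subsets_of_verts_nonempty[OF that] by (simp add: finite_subsets_of_size)
  thus ?thesis
    using assms edges_nonempty triangles_nonempty
    by (simp add: expectation_step attach_def) (simp add: field_simps)
qed

section \<open>Expected change in the number of vertices of a given degree and weight\<close>

lemma num_verts_with_out_of_range: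
  assumes "\<not> (2 \<le> d \<and> d \<le> 2 * w)"
  shows "num_verts_with G d w = 0"
proof -
  have "{v \<in> verts G. degree G v = d \<and> vertex_weight G v = w} = {}"
    using G assms by (auto simp: well_formed_def)
  thus ?thesis by (simp only: num_verts_with_def card.empty)
qed

text \<open>
  Summing over the vertices with weights turns preferential choices into the factors \<open>w\<close> and \<open>w - 1\<close> of the
  recurrence.
\<close>

lemma sum_weighted_status:
  "(\<Sum>v\<in>verts G. real (vertex_weight G v) * has_status G d w v) = real w * real (num_verts_with G d w)"
  unfolding num_verts_with_eq_sum sum_distrib_left
  by (intro sum.cong refl) (simp add: has_status_def)

text \<open>
  Exact, because both old vertices of an existing edge gain precisely one neighbour.
\<close>

lemma average_attach_edge:
  assumes "1 \<le> w" "1 \<le> d"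
  shows "(\<Sum>e\<in>#edges G. real (num_verts_with (attach e G) d w)) / real (size (edges G))
    = real (num_verts_with G d w) + of_bool (d = 2 \<and> w = 1)
      + 2 / (3 * real (size (triangles G))) *
        (real (w - 1) * real (num_verts_with G (d - 1) (w - 1)) - real w * real (num_verts_with G d w))"
proof -
  let ?X = "\<lambda>d w. real (num_verts_with G d w)" and ?i = "of_bool (d = 2 \<and> w = 1) :: real"
  let ?f = "\<lambda>v. has_status G (d - 1) (w - 1) v - has_status G d w v"
  have "(\<Sum>e\<in>#edges G. real (num_verts_with (attach e G) d w))
      = (\<Sum>e\<in>#edges G. (?X d w + ?i) + (\<Sum>v\<in>e. ?f v))"
    using num_verts_with_attach_edge[OF well_formed_coherent _ assms]
    by (intro arg_cong[where f = sum_mset] image_mset_cong) (simp add: algebra_simps)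
  also have "\<dots> = real (size (edges G)) * (?X d w + ?i) + (\<Sum>e\<in>#edges G. \<Sum>v\<in>e. ?f v)"
    by (simp add: sum_mset.distrib)
  also have "(\<Sum>e\<in>#edges G. \<Sum>v\<in>e. ?f v) = 2 * (real (w - 1) * ?X (d - 1) (w - 1) - real w * ?X d w)"
    by (subst sum_edges[OF well_formed_coherent])
       (simp add: right_diff_distrib sum_subtractf sum_weighted_status)
  finally show ?thesis
    using triangles_nonempty by (simp add: size_edges[OF well_formed_coherent] add_divide_distrib)
qed

lemma average_interact_triangle:
  assumes "1 \<le> w"
  shows "(\<Sum>T\<in>#triangles G. real (num_verts_with (interact T G) d w)) / real (size (triangles G))
    = real (num_verts_with G d w) + 1 / real (size (triangles G)) *
        (real (w - 1) * real (num_verts_with G d (w - 1)) - real w * real (num_verts_with G d w))"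
proof -
  let ?X = "\<lambda>d w. real (num_verts_with G d w)"
  let ?f = "\<lambda>v. has_status G d (w - 1) v - has_status G d w v"
  have "(\<Sum>T\<in>#triangles G. real (num_verts_with (interact T G) d w))
      = (\<Sum>T\<in>#triangles G. ?X d w + (\<Sum>v\<in>T. ?f v))"
    using num_verts_with_interact_triangle[OF well_formed_coherent _ assms]
    by (intro arg_cong[where f = sum_mset] image_mset_cong) (simp add: algebra_simps)
  also have "\<dots> = real (size (triangles G)) * ?X d w + (\<Sum>T\<in>#triangles G. \<Sum>v\<in>T. ?f v)"
    by (simp add: sum_mset.distrib)
  also have "(\<Sum>T\<in>#triangles G. \<Sum>v\<in>T. ?f v) = real (w - 1) * ?X d (w - 1) - real w * ?X d w"
    by (subst sum_triangles[OF well_formed_coherent])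
       (simp add: right_diff_distrib sum_subtractf sum_weighted_status)
  finally show ?thesis using triangles_nonempty by (simp add: add_divide_distrib)
qed

text \<open>
  Up to constants, a bound for the probability that a uniformly chosen pair or triple of vertices contains an edge.
\<close>

definition edges_per_ordered_pair :: real where
  "edges_per_ordered_pair = real (card (set_mset (edges G))) / (real (num_verts G) * (real (num_verts G) - 1))"

text \<open>
  Here and for uniformly chosen triples, the count changes by the additive expression unless an edge
  is hit. In that exceptional case both the true and the additive change are bounded by the number of old
  vertices involved.
\<close>

lemma average_attach_pair:
  assumes "1 \<le> w" "2 \<le> d"
  shows "\<bar>(\<Sum>e\<in>subsets_of_size 2 (verts G). real (num_verts_with (attach e G) d w))
        / real (card (subsets_of_size 2 (verts G)))
      - (real (num_verts_with G d w) + of_bool (d = 2 \<and> w = 1)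
        + 2 / real (num_verts G) *
          (real (num_verts_with G (d - 2) (w - 1)) - real (num_verts_with G d w)))\<bar>
    \<le> 8 * edges_per_ordered_pair"
proof -
  let ?X = "\<lambda>d w. real (num_verts_with G d w)" and ?i = "of_bool (d = 2 \<and> w = 1) :: real"
  let ?S = "subsets_of_size 2 (verts G)"
  let ?f = "\<lambda>v. has_status G (d - 2) (w - 1) v - has_status G d w v"
  let ?\<Delta> = "\<lambda>e. real (num_verts_with (attach e G) d w) - ?X d w - ?i"
  have main: "\<bar>(\<Sum>e\<in>?S. ?\<Delta> e) / real (card ?S) - real 2 / real (card (verts G)) * (\<Sum>v\<in>verts G. ?f v)\<bar>
    \<le> 4 * (real 2 * (real 2 - 1) * real (card (set_mset (edges G)))
        / (real (card (verts G)) * (real (card (verts G)) - 1)))"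
  proof (rule average_subsets_of_size_approx)
    show "2 \<le> card (verts G)" using G by (simp add: well_formed_def)
    show "e \<subseteq> verts G \<and> card e = 2" if "e \<in># edges G" for e
      using coherent_edgeD[OF well_formed_coherent that] by simp
  next
    fix e assume e: "e \<in> ?S" and "\<And>e'. e' \<in># edges G \<Longrightarrow> \<not> e' \<subseteq> e"
    hence "e \<subseteq> verts G" "card e = 2" "e \<notin># edges G" by (auto simp: subsets_of_size_def)
    thus "?\<Delta> e = (\<Sum>v\<in>e. ?f v)"
      using num_verts_with_attach_non_edge[OF well_formed_coherent _ _ _ assms] by simp
  next
    fix e assume "e \<in> ?S"
    hence e: "e \<subseteq> verts G" "card e = 2" by (auto simp: subsets_of_size_def)
    show "\<bar>?\<Delta> e - (\<Sum>v\<in>e. ?f v)\<bar> \<le> 4"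
      using num_verts_with_attach[OF well_formed_coherent e, of d w] assms e
        abs_sum_status_diff_le[of "attach e G" d w G d w e]
        abs_sum_status_diff_le[of G "d - 2" "w - 1" G d w e]
      by simp
  qed auto
  have sum_\<Delta>: "(\<Sum>e\<in>?S. ?\<Delta> e) / real (card ?S)
      = (\<Sum>e\<in>?S. real (num_verts_with (attach e G) d w)) / real (card ?S) - ?X d w - ?i"
    using subsets_of_verts_nonempty[of 2]
    by (simp add: sum_subtractf diff_divide_distrib finite_subsets_of_size)
  have sum_f: "(\<Sum>v\<in>verts G. ?f v) = ?X (d - 2) (w - 1) - ?X d w"
    by (simp add: sum_subtractf num_verts_with_eq_sum)
  have "4 * (real 2 * (real 2 - 1) * real (card (set_mset (edges G)))
        / (real (card (verts G)) * (real (card (verts G)) - 1))) = 8 * edges_per_ordered_pair"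
    by (simp add: edges_per_ordered_pair_def)
  moreover have "x - a - b - real 2 / real (card (verts G)) * y = x - (a + b + 2 / real (num_verts G) * y)"
    for x a b y :: real by simp
  ultimately show ?thesis using main unfolding sum_\<Delta> sum_f by (simp only:)
qed

lemma average_interact_triple:
  assumes "1 \<le> w" "2 \<le> d"
  shows "\<bar>(\<Sum>T\<in>subsets_of_size 3 (verts G). real (num_verts_with (interact T G) d w))
        / real (card (subsets_of_size 3 (verts G)))
      - (real (num_verts_with G d w) + 3 / real (num_verts G) *
          (real (num_verts_with G (d - 2) (w - 1)) - real (num_verts_with G d w)))\<bar>
    \<le> 36 * edges_per_ordered_pair"
proof -
  let ?X = "\<lambda>d w. real (num_verts_with G d w)"
  let ?S = "subsets_of_size 3 (verts G)"
  let ?f = "\<lambda>v. has_status G (d - 2) (w - 1) v - has_status G d w v"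
  let ?\<Delta> = "\<lambda>T. real (num_verts_with (interact T G) d w) - ?X d w"
  have main: "\<bar>(\<Sum>T\<in>?S. ?\<Delta> T) / real (card ?S) - real 3 / real (card (verts G)) * (\<Sum>v\<in>verts G. ?f v)\<bar>
    \<le> 6 * (real 3 * (real 3 - 1) * real (card (set_mset (edges G)))
        / (real (card (verts G)) * (real (card (verts G)) - 1)))"
  proof (rule average_subsets_of_size_approx)
    show "3 \<le> card (verts G)" using G by (simp add: well_formed_def)
    show "e \<subseteq> verts G \<and> card e = 2" if "e \<in># edges G" for e
      using coherent_edgeD[OF well_formed_coherent that] by simp
  next
    fix T assume T: "T \<in> ?S" and free: "\<And>e'. e' \<in># edges G \<Longrightarrow> \<not> e' \<subseteq> T"
    from T have "T \<subseteq> verts G" "card T = 3" by (auto simp: subsets_of_size_def)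
    thus "?\<Delta> T = (\<Sum>v\<in>T. ?f v)"
      using num_verts_with_interact_edgeless[OF well_formed_coherent _ _ assms free] by simp
  next
    fix T assume "T \<in> ?S"
    hence T: "T \<subseteq> verts G" "card T = 3" by (auto simp: subsets_of_size_def)
    show "\<bar>?\<Delta> T - (\<Sum>v\<in>T. ?f v)\<bar> \<le> 6"
      using num_verts_with_interact[OF well_formed_coherent T, of d w] T
        abs_sum_status_diff_le[of "interact T G" d w G d w T]
        abs_sum_status_diff_le[of G "d - 2" "w - 1" G d w T]
      by simp
  qed auto
  have sum_\<Delta>: "(\<Sum>T\<in>?S. ?\<Delta> T) / real (card ?S)
      = (\<Sum>T\<in>?S. real (num_verts_with (interact T G) d w)) / real (card ?S) - ?X d w"
    using subsets_of_verts_nonempty[of 3]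
    by (simp add: sum_subtractf diff_divide_distrib finite_subsets_of_size)
  have sum_f: "(\<Sum>v\<in>verts G. ?f v) = ?X (d - 2) (w - 1) - ?X d w"
    by (simp add: sum_subtractf num_verts_with_eq_sum)
  have "6 * (real 3 * (real 3 - 1) * real (card (set_mset (edges G)))
        / (real (card (verts G)) * (real (card (verts G)) - 1))) = 36 * edges_per_ordered_pair"
    by (simp add: edges_per_ordered_pair_def)
  moreover have "x - a - real 3 / real (card (verts G)) * y = x - (a + 3 / real (num_verts G) * y)"
    for x a y :: real by simp
  ultimately show ?thesis using main unfolding sum_\<Delta> sum_f by (simp only:)
qed

lemma edges_per_ordered_pair_le:
  "edges_per_ordered_pair \<le> 3 * real (size (triangles G)) / (real (num_verts G) * (real (num_verts G) - 1))"
proof -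
  have V: "0 \<le> real (num_verts G) * (real (num_verts G) - 1)" using G by (simp add: well_formed_def)
  have "card (set_mset (edges G)) \<le> 3 * size (triangles G)"
    using size_multiset_overloaded_eq[of "edges G"] size_edges[OF well_formed_coherent]
      sum_mono[of "set_mset (edges G)" "\<lambda>_. 1" "count (edges G)"] by (simp add: Suc_le_eq)
  hence "real (card (set_mset (edges G))) \<le> 3 * real (size (triangles G))" by linarith
  thus ?thesis unfolding edges_per_ordered_pair_def using V by (rule divide_right_mono)
qed

text \<open>
  The expected change in one step. With \<open>t\<close> of order \<open>n\<close> and \<open>V\<close> of order \<open>p * n\<close>, the main terms have order
  1 and the error has order \<open>1 / n\<close>. The two preferential rules contribute exactly \<open>\<alpha>1\<close> and \<open>\<alpha>2\<close>,
  and the two uniform rules together contribute \<open>p * \<beta>\<close>, up to the error that edges among the uniformly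
  chosen vertices cause.
\<close>

lemma expectation_num_verts_with:
  assumes p: "0 < p" "p \<le> 1" and q: "0 \<le> q" "q \<le> 1" and r: "0 \<le> r" "r \<le> 1"
    and dw: "1 \<le> w" "2 \<le> d"
  defines "t \<equiv> real (size (triangles G))" and "V \<equiv> real (num_verts G)"
    and "Y \<equiv> \<lambda>d w. real (num_verts_with G d w)"
  shows "\<bar>measure_pmf.expectation (step p q r G) (\<lambda>H. real (num_verts_with H d w))
      - (Y d w + p * of_bool (d = 2 \<and> w = 1)
         + \<alpha>1 p q / t * (real (w - 1) * Y d (w - 1) - real w * Y d w)
         + \<alpha>2 p r / t * (real (w - 1) * Y (d - 1) (w - 1) - real w * Y d w)
         + p * \<beta> p q r / V * (Y (d - 2) (w - 1) - Y d w))\<bar>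
    \<le> 132 * t / (V * (V - 1))"
proof -
  let ?i = "of_bool (d = 2 \<and> w = 1) :: real"
  define B where "B = (\<Sum>e\<in>subsets_of_size 2 (verts G). real (num_verts_with (attach e G) d w))
        / real (card (subsets_of_size 2 (verts G)))"
  define D where "D = (\<Sum>T\<in>subsets_of_size 3 (verts G). real (num_verts_with (interact T G) d w))
        / real (card (subsets_of_size 3 (verts G)))"
  define B' where "B' = Y d w + ?i + 2 / V * (Y (d - 2) (w - 1) - Y d w)"
  define D' where "D' = Y d w + 3 / V * (Y (d - 2) (w - 1) - Y d w)"
  define e1 where "e1 = (real (w - 1) * Y d (w - 1) - real w * Y d w) / t"
  define e2 where "e2 = (real (w - 1) * Y (d - 1) (w - 1) - real w * Y d w) / t"
  define e3 where "e3 = (Y (d - 2) (w - 1) - Y d w) / V"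
  have "measure_pmf.expectation (step p q r G) (\<lambda>H. real (num_verts_with H d w))
      = p * (r * (Y d w + ?i + 2 / 3 * e2) + (1 - r) * B) + (1 - p) * (q * (Y d w + e1) + (1 - q) * D)"
    using assms average_attach_edge[of w d] average_interact_triangle[of w d]
    by (simp add: expectation_step B_def D_def e1_def e2_def)
  moreover have "Y d w + p * ?i
         + \<alpha>1 p q / t * (real (w - 1) * Y d (w - 1) - real w * Y d w)
         + \<alpha>2 p r / t * (real (w - 1) * Y (d - 1) (w - 1) - real w * Y d w)
         + p * \<beta> p q r / V * (Y (d - 2) (w - 1) - Y d w)
      = p * (r * (Y d w + ?i + 2 / 3 * e2) + (1 - r) * B') + (1 - p) * (q * (Y d w + e1) + (1 - q) * D')"
  proof -
    have 1: "p * \<beta> p q r = 2 * p * (1 - r) + 3 * (1 - p) * (1 - q)"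
      using p by (simp add: \<beta>_def field_simps)
    have 2: "B' = Y d w + ?i + 2 * e3" "D' = Y d w + 3 * e3"
      by (simp_all add: B'_def D'_def e3_def)
    have 3: "\<alpha>1 p q / t * (real (w - 1) * Y d (w - 1) - real w * Y d w) = \<alpha>1 p q * e1"
      "\<alpha>2 p r / t * (real (w - 1) * Y (d - 1) (w - 1) - real w * Y d w) = \<alpha>2 p r * e2"
      "p * \<beta> p q r / V * (Y (d - 2) (w - 1) - Y d w) = p * \<beta> p q r * e3"
      by (simp_all add: e1_def e2_def e3_def)
    have alg: "y + p * i + (1 - p) * q * e1 + 2 * p * r / 3 * e2 + (2 * p * (1 - r) + 3 * (1 - p) * (1 - q)) * e3
        = p * (r * (y + i + 2 / 3 * e2) + (1 - r) * (y + i + 2 * e3))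
          + (1 - p) * (q * (y + e1) + (1 - q) * (y + 3 * e3))" for y i :: real
      by (simp add: algebra_simps)
    show ?thesis unfolding 3 unfolding 1 2 \<alpha>1_def \<alpha>2_def by (rule alg)
  qed
  ultimately have "measure_pmf.expectation (step p q r G) (\<lambda>H. real (num_verts_with H d w))
      - (Y d w + p * ?i
         + \<alpha>1 p q / t * (real (w - 1) * Y d (w - 1) - real w * Y d w)
         + \<alpha>2 p r / t * (real (w - 1) * Y (d - 1) (w - 1) - real w * Y d w)
         + p * \<beta> p q r / V * (Y (d - 2) (w - 1) - Y d w))
      = p * (1 - r) * (B - B') + (1 - p) * (1 - q) * (D - D')" (is "?lhs = _")
    by (simp add: algebra_simps)
  also have "\<bar>\<dots>\<bar> \<le> \<bar>B - B'\<bar> + \<bar>D - D'\<bar>"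
  proof -
    have "\<bar>p * (1 - r) * (B - B')\<bar> \<le> \<bar>B - B'\<bar>" "\<bar>(1 - p) * (1 - q) * (D - D')\<bar> \<le> \<bar>D - D'\<bar>"
      using p q r by (auto simp: abs_mult intro!: mult_left_le_one_le mult_le_one)
    thus ?thesis by linarith
  qed
  \<comment> \<open>The error constant is \<open>3 * (8 + 36)\<close>, since there are at most \<open>3 * t\<close> edges.\<close>
  also have "\<dots> \<le> 8 * edges_per_ordered_pair + 36 * edges_per_ordered_pair"
    using average_attach_pair[OF dw] average_interact_triple[OF dw]
    by (intro add_mono) (simp_all add: B_def B'_def D_def D'_def Y_def V_def)
  also have "\<dots> \<le> 132 * t / (V * (V - 1))"
    using edges_per_ordered_pair_le by (simp add: t_def V_def)
  finally show ?thesis .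
qed

end

section \<open>The limiting shares\<close>

text \<open>
  The limits, with the weight as the first argument because the recursion is on the weight. A single clause
  covers the initial value as well: for weight 1 the factors \<open>real w\<close> and the limits for weight 0 vanish,
  and only the contribution of new vertices remains.
\<close>

primrec limit_share :: "real \<Rightarrow> real \<Rightarrow> real \<Rightarrow> nat \<Rightarrow> nat \<Rightarrow> real" where
  "limit_share p q r 0 d = 0"
| "limit_share p q r (Suc w) d = (if 2 \<le> d \<and> d \<le> 2 * Suc w then
     (of_bool (d = 2 \<and> w = 0) + \<alpha>1 p q * real w * limit_share p q r w d
       + \<alpha>2 p r * real w * limit_share p q r w (d - 1) + \<beta> p q r * limit_share p q r w (d - 2))
     / (\<alpha> p q r * real (Suc w) + \<beta> p q r + 1) else 0)"

lemma limit_share_out_of_range: "\<not> (2 \<le> d \<and> d \<le> 2 * w) \<Longrightarrow> limit_share p q r w d = 0"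
  by (cases w) auto

lemma limit_share_recurrence:
  assumes "2 \<le> w" "2 \<le> d" "d \<le> 2 * w"
  shows "limit_share p q r w d = 1 / (\<alpha> p q r * real w + \<beta> p q r + 1) *
         (\<alpha>1 p q * real (w - 1) * limit_share p q r (w - 1) d
          + \<alpha>2 p r * real (w - 1) * limit_share p q r (w - 1) (d - 1)
          + \<beta> p q r * limit_share p q r (w - 1) (d - 2))"
  using assms by (cases w) auto

lemma limit_share_start: "limit_share p q r 1 2 = 1 / (\<alpha> p q r + \<beta> p q r + 1)"
  by simp

context
  fixes p q r :: real
  assumes p: "0 < p" "p \<le> 1" and q: "0 \<le> q" "q \<le> 1" and r: "0 \<le> r" "r \<le> 1"
begin

lemma parameters_nonneg: "0 \<le> \<alpha>1 p q" "0 \<le> \<alpha>2 p r" "0 \<le> \<alpha> p q r" "0 \<le> \<beta> p q r"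
  using p q r by (auto simp: \<alpha>1_def \<alpha>2_def \<alpha>_def \<beta>_def)

lemma limit_share_nonneg: "0 \<le> limit_share p q r w d"
  by (induction w arbitrary: d) (auto intro!: divide_nonneg_nonneg add_nonneg_nonneg simp: parameters_nonneg)

text \<open>
  Each admissible pair \<open>(d, w + 1)\<close> with \<open>w \<ge> 1\<close> is fed by an admissible pair of weight \<open>w\<close>: by \<open>(d, w)\<close>
  if \<open>d \<le> 2 * w\<close>, by \<open>(d - 1, w)\<close> if \<open>d = 2 * w + 1\<close>, and by \<open>(d - 2, w)\<close> if \<open>d = 2 * w + 2\<close>. Each of the three
  coefficients is needed in one of these cases.
\<close>

lemma limit_share_pos:
  assumes pos: "0 < \<alpha>1 p q" "0 < \<alpha>2 p r" "0 < \<beta> p q r"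
  shows "2 \<le> d \<Longrightarrow> d \<le> 2 * w \<Longrightarrow> 0 < limit_share p q r w d"
proof (induction w arbitrary: d)
  case (Suc w)
  let ?x = "limit_share p q r w"
  let ?a = "\<alpha>1 p q * real w * ?x d" and ?b = "\<alpha>2 p r * real w * ?x (d - 1)" and ?c = "\<beta> p q r * ?x (d - 2)"
  have nonneg: "0 \<le> ?a" "0 \<le> ?b" "0 \<le> ?c"
    using pos by (auto intro!: mult_nonneg_nonneg limit_share_nonneg)
  have "0 < of_bool (d = 2 \<and> w = 0) + ?a + ?b + ?c"
  proof (cases "w = 0")
    case True
    hence "d = 2" using Suc.prems by simp
    thus ?thesis using True nonneg by simp
  next
    case False
    have "d \<le> 2 * w \<or> d = 2 * w + 1 \<or> d = 2 * w + 2" using Suc.prems by arith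
    then consider "d \<le> 2 * w" | "d = 2 * w + 1" | "d = 2 * w + 2" by blast
    hence "0 < ?a \<or> 0 < ?b \<or> 0 < ?c"
      using Suc False pos by cases auto
    thus ?thesis using nonneg by auto
  qed
  moreover have "0 < \<alpha> p q r * real (Suc w) + \<beta> p q r + 1"
    using parameters_nonneg by (intro add_nonneg_pos add_nonneg_nonneg) auto
  ultimately show ?case using Suc.prems by simp
qed simp

section \<open>Convergence\<close>

text \<open>
  The deterministic core of the induction step, along a single path. The expected change has the
  form \<open>b n - c n * y n\<close> with \<open>n * c n\<close> tending to \<open>\<alpha> * w + \<beta>\<close>: the loss terms collect in \<open>c\<close>, the gains from
  smaller weights in \<open>b\<close>, and the approximation error, which tends to 0, is absorbed in \<open>b\<close>.
\<close>

lemma path_limit: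
  fixes g :: "nat \<Rightarrow> graph_state" and \<xi> :: "nat \<Rightarrow> real"
  assumes well_formed: "\<And>n. well_formed (g n)"
    and size: "\<And>n. size (triangles (g n)) = Suc n"
    and V_lim: "(\<lambda>n. real (num_verts (g n)) / real n) \<longlonglongrightarrow> p"
    and dw: "1 \<le> w" "2 \<le> d"
    and noise: "(\<lambda>n. (\<Sum>k<n. \<xi> k) / real n) \<longlonglongrightarrow> 0"
    and next_value: "\<And>n. real (num_verts_with (g (Suc n)) d w) =
      measure_pmf.expectation (step p q r (g n)) (\<lambda>H. real (num_verts_with H d w)) + \<xi> n"
    and l1: "(\<lambda>n. real (num_verts_with (g n) d (w - 1)) / real n) \<longlonglongrightarrow> l1"
    and l2: "(\<lambda>n. real (num_verts_with (g n) (d - 1) (w - 1)) / real n) \<longlonglongrightarrow> l2"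
    and l3: "(\<lambda>n. real (num_verts_with (g n) (d - 2) (w - 1)) / real n) \<longlonglongrightarrow> l3"
  shows "(\<lambda>n. real (num_verts_with (g n) d w) / real n) \<longlonglongrightarrow>
    (p * of_bool (d = 2 \<and> w = 1) + \<alpha>1 p q * real (w - 1) * l1 + \<alpha>2 p r * real (w - 1) * l2
      + \<beta> p q r * l3) / (1 + (\<alpha> p q r * real w + \<beta> p q r))"
proof -
  define V where "V n = real (num_verts (g n))" for n
  define Y where "Y n d w = real (num_verts_with (g n) d w)" for n d w
  have V3: "3 \<le> V n" for n using well_formed[of n] by (simp add: V_def well_formed_def)
  define err where "err n = measure_pmf.expectation (step p q r (g n)) (\<lambda>H. real (num_verts_with H d w))
      - (Y n d w + p * of_bool (d = 2 \<and> w = 1)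
         + \<alpha>1 p q / real (Suc n) * (real (w - 1) * Y n d (w - 1) - real w * Y n d w)
         + \<alpha>2 p r / real (Suc n) * (real (w - 1) * Y n (d - 1) (w - 1) - real w * Y n d w)
         + p * \<beta> p q r / V n * (Y n (d - 2) (w - 1) - Y n d w))" for n
  have err_bound: "\<bar>err n\<bar> \<le> 132 * real (Suc n) / (V n * (V n - 1))" for n
    using expectation_num_verts_with[OF well_formed p q r dw, of n]
    unfolding err_def Y_def V_def size .
  define c where "c n = \<alpha> p q r * real w / real (Suc n) + p * \<beta> p q r / V n" for n
  define b where "b n = p * of_bool (d = 2 \<and> w = 1)
      + \<alpha>1 p q * real (w - 1) * (Y n d (w - 1) / real (Suc n))
      + \<alpha>2 p r * real (w - 1) * (Y n (d - 1) (w - 1) / real (Suc n))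
      + \<beta> p q r * p * (Y n (d - 2) (w - 1) / V n) + err n" for n
  have ratio: "(\<lambda>n. real n / real (Suc n)) \<longlonglongrightarrow> 1" by (rule LIMSEQ_n_over_Suc_n)
  have over_Suc: "(\<lambda>n. y n / real (Suc n)) \<longlonglongrightarrow> l" if "(\<lambda>n. y n / real n) \<longlonglongrightarrow> l" for y :: "nat \<Rightarrow> real" and l
  proof -
    have "(\<lambda>n. y n / real n * (real n / real (Suc n))) \<longlonglongrightarrow> l * 1" by (intro tendsto_mult that ratio)
    moreover have "eventually (\<lambda>n. y n / real n * (real n / real (Suc n)) = y n / real (Suc n)) sequentially"
      using eventually_gt_at_top[of 0] by eventually_elim simp
    ultimately show ?thesis by (auto intro: Lim_transform_eventually)
  qed
  have over_V: "(\<lambda>n. y n / V n) \<longlonglongrightarrow> l / p" if "(\<lambda>n. y n / real n) \<longlonglongrightarrow> l" for y :: "nat \<Rightarrow> real" and l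
  proof -
    have "(\<lambda>n. (y n / real n) / (V n / real n)) \<longlonglongrightarrow> l / p"
      using p V_lim unfolding V_def by (intro tendsto_divide that) auto
    moreover have "eventually (\<lambda>n. (y n / real n) / (V n / real n) = y n / V n) sequentially"
      using eventually_gt_at_top[of 0] by eventually_elim simp
    ultimately show ?thesis by (auto intro: Lim_transform_eventually)
  qed
  have n_over_n: "(\<lambda>n. real n / real n) \<longlonglongrightarrow> 1"
    by (rule tendsto_eventually) (use eventually_gt_at_top[of 0] in eventually_elim, simp)
  have err_lim: "err \<longlonglongrightarrow> 0"
  proof (rule Lim_null_comparison)
    show "\<forall>\<^sub>F n in sequentially. norm (err n) \<le> 132 * real (Suc n) / (V n * (V n - 1))"
      using err_bound by simp
    have "(\<lambda>n. 132 * (1 / real n + 1 / real n * (1 / real n)) / ((V n / real n) * (V n / real n - 1 / real n)))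
        \<longlonglongrightarrow> 132 * (0 + 0 * 0) / (p * (p - 0))"
      using p V_lim unfolding V_def
      by (intro tendsto_intros lim_1_over_n) auto
    moreover have "eventually (\<lambda>n. 132 * (1 / real n + 1 / real n * (1 / real n))
          / ((V n / real n) * (V n / real n - 1 / real n))
        = 132 * real (Suc n) / (V n * (V n - 1))) sequentially"
      using eventually_gt_at_top[of 0]
    proof eventually_elim
      case (elim n)
      have "1 / real n + 1 / real n * (1 / real n) = real (Suc n) / (real n * real n)"
        using elim by (simp add: field_simps)
      moreover have "(V n / real n) * (V n / real n - 1 / real n) = V n * (V n - 1) / (real n * real n)"
        by (simp add: diff_divide_distrib[symmetric])
      ultimately show ?case using elim by simp
    qed
    ultimately show "(\<lambda>n. 132 * real (Suc n) / (V n * (V n - 1))) \<longlonglongrightarrow> 0"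
      by (auto intro: Lim_transform_eventually)
  qed
  have rec: "Y (Suc n) d w - Y n d w = b n - c n * Y n d w + \<xi> n" for n
  proof -
    have "Y (Suc n) d w - Y n d w = p * of_bool (d = 2 \<and> w = 1)
         + \<alpha>1 p q / real (Suc n) * (real (w - 1) * Y n d (w - 1) - real w * Y n d w)
         + \<alpha>2 p r / real (Suc n) * (real (w - 1) * Y n (d - 1) (w - 1) - real w * Y n d w)
         + p * \<beta> p q r / V n * (Y n (d - 2) (w - 1) - Y n d w) + err n + \<xi> n"
      using next_value[of n] by (simp add: err_def Y_def)
    moreover have "i + a1 / s * (u * y1 - v * y) + a2 / s * (u * y2 - v * y) + x * \<beta>' / V' * (y3 - y) + e + z
      = (i + a1 * u * (y1 / s) + a2 * u * (y2 / s) + \<beta>' * x * (y3 / V') + e)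
        - ((a1 + a2) * v / s + x * \<beta>' / V') * y + z"
      for i a1 a2 s u v y y1 y2 y3 x \<beta>' V' e z :: real
      by (simp add: diff_divide_distrib add_divide_distrib ring_distribs mult_ac)
    ultimately show ?thesis unfolding b_def c_def \<alpha>_def by (simp only:)
  qed
  have "(\<lambda>n. Y n d w / real n) \<longlonglongrightarrow>
    (p * of_bool (d = 2 \<and> w = 1) + \<alpha>1 p q * real (w - 1) * l1 + \<alpha>2 p r * real (w - 1) * l2
      + \<beta> p q r * p * (l3 / p) + 0) / (1 + (\<alpha> p q r * real w * 1 + p * \<beta> p q r * (1 / p)))"
  proof (rule noisy_linear_recursion_limit[where y = "\<lambda>n. Y n d w" and b = b and c = c, OF rec noise])
    show "0 \<le> c n" for n
      using V3[of n] p parameters_nonneg by (simp add: c_def)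
    show "b \<longlonglongrightarrow> p * of_bool (d = 2 \<and> w = 1) + \<alpha>1 p q * real (w - 1) * l1
        + \<alpha>2 p r * real (w - 1) * l2 + \<beta> p q r * p * (l3 / p) + 0"
      unfolding b_def Y_def
      by (intro tendsto_add tendsto_mult tendsto_const over_Suc over_V err_lim l1 l2 l3)
    have "(\<lambda>n. \<alpha> p q r * real w * (real n / real (Suc n)) + p * \<beta> p q r * (real n / V n))
        \<longlonglongrightarrow> \<alpha> p q r * real w * 1 + p * \<beta> p q r * (1 / p)"
      by (intro tendsto_add tendsto_mult tendsto_const ratio over_V n_over_n)
    moreover have "(\<lambda>n. \<alpha> p q r * real w * (real n / real (Suc n)) + p * \<beta> p q r * (real n / V n))
        = (\<lambda>n. real n * c n)"
      by (rule ext) (simp add: c_def ring_distribs mult_ac)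
    ultimately show "(\<lambda>n. real n * c n) \<longlonglongrightarrow> \<alpha> p q r * real w * 1 + p * \<beta> p q r * (1 / p)" by simp
    show "0 \<le> \<alpha> p q r * real w * 1 + p * \<beta> p q r * (1 / p)"
      using p parameters_nonneg by simp
  qed
  thus ?thesis using p by (simp add: Y_def)
qed

context
  fixes M :: "'a measure" and G :: "nat \<Rightarrow> 'a \<Rightarrow> graph_state"
  assumes process: "graph_process p q r M G"
begin

lemma chain: "finitely_branching_chain M (step p q r) init_state (Collect well_formed) G"
proof -
  interpret prob_space M using process by (simp add: graph_process_def)
  show ?thesis
    using process
    by unfold_locales (auto simp: graph_process_def well_formed_init well_formed_step finite_set_pmf_step)
qed

interpretation finitely_branching_chain M "step p q r" init_state "Collect well_formed" G
  by (rule chain)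

lemma AE_well_formed_path:
  "AE \<omega> in M. \<forall>n. well_formed (G n \<omega>) \<and> size (triangles (G n \<omega>)) = Suc n"
  using AE_path
proof eventually_elim
  case (elim \<omega>)
  have "size (triangles (G n \<omega>)) = Suc n" for n
  proof (induction n)
    case 0
    show ?case using elim by (simp add: init_state_def)
  next
    case (Suc n)
    thus ?case using elim size_triangles_step[of "G n \<omega>" "G (Suc n) \<omega>" p q r] by auto
  qed
  thus ?case using elim by auto
qed

lemma AE_num_verts_growth: "AE \<omega> in M. (\<lambda>n. real (num_verts (G n \<omega>)) / real n) \<longlonglongrightarrow> p"
proof -
  let ?V = "\<lambda>H. real (num_verts H)"
  have "AE \<omega> in M. (\<lambda>n. (\<Sum>k<n. noise ?V k \<omega>) / real n) \<longlonglongrightarrow> 0"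
    by (rule noise_mean_null[where C = 1]) (use num_verts_step in auto)
  thus ?thesis using AE_well_formed_path
  proof eventually_elim
    case (elim \<omega>)
    have "(\<lambda>n. ?V (G n \<omega>) / real n) \<longlonglongrightarrow> p / (1 + 0)"
    proof (rule noisy_linear_recursion_limit[where b = "\<lambda>_. p" and c = "\<lambda>_. 0"])
      show "?V (G (Suc n) \<omega>) - ?V (G n \<omega>) = p - 0 * ?V (G n \<omega>) + noise ?V n \<omega>" for n
        using elim p q r by (simp add: noise_def expectation_num_verts)
    qed (use elim in auto)
    thus ?case by simp
  qed
qed

text \<open>
  Induction on the weight, for all degrees at once: the gains come from weight \<open>w\<close>, where the
  limits are already known. Dividing by \<open>n\<close> instead of the number of vertices puts the factor \<open>p\<close> in front.
\<close>

lemma AE_num_verts_with_growth: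
  "AE \<omega> in M. (\<lambda>n. real (num_verts_with (G n \<omega>) d w) / real n) \<longlonglongrightarrow> p * limit_share p q r w d"
proof (induction w arbitrary: d)
  case 0
  show ?case using AE_well_formed_path
    by eventually_elim (simp add: num_verts_with_out_of_range)
next
  case (Suc w)
  let ?X = "\<lambda>H. real (num_verts_with H d (Suc w))"
  show ?case
  proof (cases "2 \<le> d \<and> d \<le> 2 * Suc w")
    case False
    show ?thesis using AE_well_formed_path
      by eventually_elim (use False in \<open>simp add: num_verts_with_out_of_range limit_share_out_of_range del: limit_share.simps\<close>)
  next
    case True
    have "AE \<omega> in M. (\<lambda>n. (\<Sum>k<n. noise ?X k \<omega>) / real n) \<longlonglongrightarrow> 0"
      by (rule noise_mean_null[where C = 3]) (use True in \<open>auto intro!: num_verts_with_step\<close>)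
    thus ?thesis using AE_well_formed_path AE_num_verts_growth Suc.IH[of d] Suc.IH[of "d - 1"] Suc.IH[of "d - 2"]
    proof eventually_elim
      case (elim \<omega>)
      let ?l = "(p * of_bool (d = 2 \<and> Suc w = 1) + \<alpha>1 p q * real (Suc w - 1) * (p * limit_share p q r w d)
          + \<alpha>2 p r * real (Suc w - 1) * (p * limit_share p q r w (d - 1))
          + \<beta> p q r * (p * limit_share p q r w (d - 2))) / (1 + (\<alpha> p q r * real (Suc w) + \<beta> p q r))"
      have "(\<lambda>n. ?X (G n \<omega>) / real n) \<longlonglongrightarrow> ?l"
        by (rule path_limit[where g = "\<lambda>n. G n \<omega>" and \<xi> = "\<lambda>n. noise ?X n \<omega>"])
           (use elim True in \<open>auto simp: noise_def\<close>)
      moreover have "?l = p * limit_share p q r (Suc w) d"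
      proof -
        have "(p * i + a * u * (p * x) + b * u * (p * y) + c * (p * z)) / (1 + (s + c))
          = p * ((i + a * u * x + b * u * y + c * z) / (s + c + 1))" for i a u x b y c z s :: real
          by (simp add: ring_distribs mult_ac add_ac)
        thus ?thesis using True by simp
      qed
      ultimately show ?case by (simp only:)
    qed
  qed
qed

lemma AE_share_limit:
  "AE \<omega> in M. (\<lambda>n. real (num_verts_with (G n \<omega>) d w) / real (num_verts (G n \<omega>)))
     \<longlonglongrightarrow> limit_share p q r w d"
  using AE_num_verts_with_growth[of d w] AE_num_verts_growth
proof eventually_elim
  case (elim \<omega>)
  let ?X = "\<lambda>n. real (num_verts_with (G n \<omega>) d w)" and ?V = "\<lambda>n. real (num_verts (G n \<omega>))"
  have "(\<lambda>n. (?X n / real n) / (?V n / real n)) \<longlonglongrightarrow> p * limit_share p q r w d / p"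
    using p by (intro tendsto_divide elim) auto
  moreover have "eventually (\<lambda>n. (?X n / real n) / (?V n / real n) = ?X n / ?V n) sequentially"
    using eventually_gt_at_top[of 0] by eventually_elim simp
  ultimately show ?case using p by (auto intro: Lim_transform_eventually)
qed

end

end

theorem theorem3p1:
  fixes p q r :: real
    and M :: "'a measure"
    and G :: "nat \<Rightarrow> 'a \<Rightarrow> graph_state"
  assumes "0 < p" "p \<le> 1"
    and "0 \<le> q" "q \<le> 1"
    and "0 \<le> r" "r \<le> 1"
    and "graph_process p q r M G"
  shows "\<exists>x :: nat \<Rightarrow> nat \<Rightarrow> real.
    (\<forall>d w. 1 \<le> w \<and> 2 \<le> d \<and> d \<le> 2 * w \<longrightarrow>
       (AE \<omega> in M. (\<lambda>n. real (num_verts_with (G n \<omega>) d w) / real (num_verts (G n \<omega>)))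
                      \<longlonglongrightarrow> x d w)) \<and>
    (\<forall>d w. 0 \<le> x d w) \<and>
    (0 < \<alpha>1 p q \<and> 0 < \<alpha>2 p r \<and> 0 < \<beta> p q r \<longrightarrow>
       (\<forall>d w. 1 \<le> w \<and> 2 \<le> d \<and> d \<le> 2 * w \<longrightarrow> 0 < x d w)) \<and>
    x 2 1 = 1 / (\<alpha> p q r + \<beta> p q r + 1) \<and>
    (\<forall>d w. 2 \<le> w \<and> 2 \<le> d \<and> d \<le> 2 * w \<longrightarrow>
       x d w = 1 / (\<alpha> p q r * real w + \<beta> p q r + 1) *
         (\<alpha>1 p q * real (w - 1) * x d (w - 1)
          + \<alpha>2 p r * real (w - 1) * x (d - 1) (w - 1)
          + \<beta> p q r * x (d - 2) (w - 1))) \<and>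
    (\<forall>d w. \<not> (2 \<le> d \<and> d \<le> 2 * w) \<longrightarrow> x d w = 0)"
proof (intro exI[of _ "\<lambda>d w. limit_share p q r w d"] conjI allI impI)
  note params = assms(1-6)
  show "AE \<omega> in M. (\<lambda>n. real (num_verts_with (G n \<omega>) d w) / real (num_verts (G n \<omega>)))
      \<longlonglongrightarrow> limit_share p q r w d" for d w
    by (rule AE_share_limit[OF params assms(7)])
  show "0 \<le> limit_share p q r w d" for d w by (rule limit_share_nonneg[OF params])
  show "limit_share p q r 1 2 = 1 / (\<alpha> p q r + \<beta> p q r + 1)" by (rule limit_share_start)
qed (use limit_share_pos[OF assms(1-6)] limit_share_recurrence limit_share_out_of_range in \<open>blast+\<close>)

end
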